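(* Let $n\ge 3$ and $p\in(0,1]$. Consider the following three distributions over graphs on $[n]$. (1) $\mathcal{A}_1$: the $G(n,p)$ model, where each of the $\binom{n}{2}$ possible edges is present independently with probability $p$. This is an edge independent model. (2) $\mathcal{A}_2$: each node independently becomes active with probability $\sqrt{p}$, and the edges of the graph are exactly all pairs of distinct active nodes. This is a node independent model. (3) $\mathcal{A}_3$: the complete graph with probability $p$ and the empty graph with probability $1-p$. This is a fully dependent model. Each of $\mathcal{A}_1,\mathcal{A}_2,\mathcal{A}_3$ has overlap exactly $p$, and the expected number of triangles of a sample is $\Theta(n^3\cdot \mathrm{Ov}(\mathcal{A}_1)^3)$, $\Theta(n^3\cdot \mathrm{Ov}(\mathcal{A}_2)^{3/2})$, and $\Theta(n^3\cdot \mathrm{Ov}(\mathcal{A}_3))$, respectively, where the constants implicit in $\Theta$ are absolute (independent of $n$ and $p$). Consequently the upper bounds $\frac{1}{6}n^3\,\mathrm{Ov}(\mathcal{A})^3$, $\frac{1}{6}n^3\,\mathrm{Ov}(\mathcal{A})^{3/2}$ and $\frac{1}{2}n^3\,\mathrm{Ov}(\mathcal{A})$ on the expected number of triangles for, respectively, edge independent, node independent and fully dependent models are tight up to constant factors.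
   Context: All graphs are undirected, unweighted, node-labeled, on the vertex set $[n]=\{1,\dots,n\}$, without self-loops; a graph is identified with its symmetric adjacency matrix in $\{0,1\}^{n\times n}$ (zero diagonal). A graph generative model is a probability distribution $\mathcal{A}$ over such adjacency matrices. Volume: $\mathrm{Vol}(\mathcal{A}) := \mathbb{E}_{\bm{A}\sim\mathcal{A}}\big[\sum_{i<j}\bm{A}_{ij}\big]$. Overlap: $\mathrm{Ov}(\mathcal{A}) := \mathbb{E}_{\bm{A},\bm{A}'\sim\mathcal{A}}\big[\sum_{i<j}\bm{A}_{ij}\bm{A}'_{ij}\big]/\mathrm{Vol}(\mathcal{A})$, where $\bm{A},\bm{A}'$ are two independent samples from $\mathcal{A}$ (and $\mathrm{Vol}(\mathcal{A})>0$). Edge independent model: for some symmetric $\bm{P}\in[0,1]^{n\times n}$, $\bm{A}_{ij}=\bm{A}_{ji}=1$ with probability $\bm{P}_{ij}$ and $0$ otherwise, with the entries $\bm{A}_{ij}$, $i<j$, mutually independent. Node independent model: for some embedding space $\mathcal{E}$, mutually independent random variables $\bm{x_1},\dots,\bm{x_n}\in\mathcal{E}$, and symmetric $e:\mathcal{E}\times\mathcal{E}\to[0,1]$, the entries $\bm{A}_{ij}=\bm{A}_{ji}$, $i<j$, are Bernoulli with parameter $e(\bm{x_i},\bm{x_j})$ and mutually independent conditioned on $\bm{x_1},\dots,\bm{x_n}$. Fully dependent model: an arbitrary distribution over adjacency matrices. A triangle is an unordered set of three distinct, pairwise adjacent nodes. *)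

theory Defs
  imports "HOL-Probability.Probability"
begin

text \<open>
  Graphs on \<open>{1..n}\<close> are 0/1 adjacency matrices, represented as functions on \<open>nat \<times> nat\<close> that
  vanish outside \<open>{1..n} \<times> {1..n}\<close>, so that every graph has exactly one representation.
  A model is a distribution on this finite set, hence a \<open>pmf\<close>.
\<close>

type_synonym adj_matrix = "nat \<Rightarrow> nat \<Rightarrow> nat"

definition adj_matrices :: "nat \<Rightarrow> adj_matrix set" where
  "adj_matrices n = {G. (\<forall>i j. G i j \<in> {0, 1}) \<and> (\<forall>i j. G i j = G j i) \<and> (\<forall>i. G i i = 0) \<and>
                        (\<forall>i j. i \<notin> {1..n} \<or> j \<notin> {1..n} \<longrightarrow> G i j = 0)}"

definition graph_model :: "nat \<Rightarrow> adj_matrix pmf \<Rightarrow> bool" where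
  "graph_model n A \<longleftrightarrow> set_pmf A \<subseteq> adj_matrices n"

definition node_pairs :: "nat \<Rightarrow> (nat \<times> nat) set" where
  "node_pairs n = {(i, j). 1 \<le> i \<and> i < j \<and> j \<le> n}"

definition Vol :: "nat \<Rightarrow> adj_matrix pmf \<Rightarrow> real" where
  "Vol n A = measure_pmf.expectation A (\<lambda>G. \<Sum>(i, j)\<in>node_pairs n. real (G i j))"

definition Ov :: "nat \<Rightarrow> adj_matrix pmf \<Rightarrow> real" where
  "Ov n A = measure_pmf.expectation (pair_pmf A A)
              (\<lambda>(G, H). \<Sum>(i, j)\<in>node_pairs n. real (G i j) * real (H i j)) / Vol n A"

definition triangles :: "nat \<Rightarrow> adj_matrix \<Rightarrow> nat set set" where
  "triangles n G = {T. T \<subseteq> {1..n} \<and> card T = 3 \<and> (\<forall>i\<in>T. \<forall>j\<in>T. i \<noteq> j \<longrightarrow> G i j = 1)}"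

definition expected_triangles :: "nat \<Rightarrow> adj_matrix pmf \<Rightarrow> real" where
  "expected_triangles n A = measure_pmf.expectation A (\<lambda>G. real (card (triangles n G)))"


definition edge_independent_with ::
    "nat \<Rightarrow> (nat \<Rightarrow> nat \<Rightarrow> real) \<Rightarrow> adj_matrix pmf \<Rightarrow> bool" where
  "edge_independent_with n P A \<longleftrightarrow>
     graph_model n A \<and>
     (\<forall>i\<in>{1..n}. \<forall>j\<in>{1..n}. P i j = P j i \<and> 0 \<le> P i j \<and> P i j \<le> 1) \<and>
     (\<forall>(i, j)\<in>node_pairs n. measure_pmf.prob A {G. G i j = 1} = P i j) \<and>
     prob_space.indep_vars (measure_pmf A) (\<lambda>_. count_space UNIV) (\<lambda>(i, j) G. G i j) (node_pairs n)"

definition edge_independent :: "nat \<Rightarrow> adj_matrix pmf \<Rightarrow> bool" where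
  "edge_independent n A \<longleftrightarrow> (\<exists>P. edge_independent_with n P A)"

text \<open>
  \<open>E\<close> is the embedding space and \<open>M\<close> the probability space carrying the embeddings \<open>x i\<close>; they are
  parameters because HOL cannot quantify over their types. \<open>K \<omega>\<close> is the conditional law of the
  graph given \<open>x 1 \<omega>, \<dots>, x n \<omega>\<close>. The integrand \<open>pmf (K \<omega>) G\<close> is automatically measurable: on
  adjacency matrices it is a product of factors \<open>e (x i \<omega>) (x j \<omega>)\<close> and \<open>1 - e (x i \<omega>) (x j \<omega>)\<close>.
\<close>

definition node_independent ::
    "'w measure \<Rightarrow> 'e measure \<Rightarrow> nat \<Rightarrow> adj_matrix pmf \<Rightarrow> bool" where
  "node_independent M E n A \<longleftrightarrow>
     graph_model n A \<and> prob_space M \<and>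
     (\<exists>(x :: nat \<Rightarrow> 'w \<Rightarrow> 'e) (e :: 'e \<Rightarrow> 'e \<Rightarrow> real) (K :: 'w \<Rightarrow> adj_matrix pmf).
        prob_space.indep_vars M (\<lambda>_. E) x {1..n} \<and>
        (\<lambda>(a, b). e a b) \<in> borel_measurable (E \<Otimes>\<^sub>M E) \<and>
        (\<forall>a\<in>space E. \<forall>b\<in>space E. e a b = e b a \<and> 0 \<le> e a b \<and> e a b \<le> 1) \<and>
        (\<forall>\<omega>\<in>space M. edge_independent_with n (\<lambda>i j. e (x i \<omega>) (x j \<omega>)) (K \<omega>)) \<and>
        (\<forall>G. pmf A G = (\<integral>\<omega>. pmf (K \<omega>) G \<partial>M)))"

definition fully_dependent :: "nat \<Rightarrow> adj_matrix pmf \<Rightarrow> bool" where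
  "fully_dependent n A \<longleftrightarrow> graph_model n A"


definition adj_of :: "nat \<Rightarrow> (nat \<Rightarrow> nat \<Rightarrow> bool) \<Rightarrow> adj_matrix" where
  "adj_of n R = (\<lambda>i j. if i \<in> {1..n} \<and> j \<in> {1..n} \<and> i \<noteq> j \<and> R i j then 1 else 0)"

definition gnp_model :: "nat \<Rightarrow> real \<Rightarrow> adj_matrix pmf" where
  "gnp_model n p = map_pmf (\<lambda>b. adj_of n (\<lambda>i j. b (min i j, max i j)))
                     (Pi_pmf (node_pairs n) False (\<lambda>_. bernoulli_pmf p))"

definition active_clique_model :: "nat \<Rightarrow> real \<Rightarrow> adj_matrix pmf" where
  "active_clique_model n p = map_pmf (\<lambda>a. adj_of n (\<lambda>i j. a i \<and> a j))
                               (Pi_pmf {1..n} False (\<lambda>_. bernoulli_pmf (sqrt p)))"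

definition all_or_nothing_model :: "nat \<Rightarrow> real \<Rightarrow> adj_matrix pmf" where
  "all_or_nothing_model n p =
     map_pmf (\<lambda>b. if b then adj_of n (\<lambda>i j. True) else adj_of n (\<lambda>i j. False)) (bernoulli_pmf p)"


text \<open>
  A class \<open>C\<close> of models assigns to each \<open>n\<close> a set of models on \<open>{1..n}\<close>, and \<open>U n v\<close> is a candidate
  bound in terms of \<open>n\<close> and the overlap \<open>v\<close>. Tightness up to constant factors means that, with an
  absolute constant, the bound is attained for every \<open>n \<ge> 3\<close> and every overlap in \<open>{0<..1}\<close>.
\<close>

definition triangle_upper_bound ::
    "(nat \<Rightarrow> adj_matrix pmf \<Rightarrow> bool) \<Rightarrow> (nat \<Rightarrow> real \<Rightarrow> real) \<Rightarrow> bool" where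
  "triangle_upper_bound C U \<longleftrightarrow>
     (\<forall>n\<ge>3. \<forall>A. C n A \<and> Vol n A > 0 \<longrightarrow> expected_triangles n A \<le> U n (Ov n A))"

definition triangle_bound_attained ::
    "(nat \<Rightarrow> adj_matrix pmf \<Rightarrow> bool) \<Rightarrow> (nat \<Rightarrow> real \<Rightarrow> real) \<Rightarrow> bool" where
  "triangle_bound_attained C U \<longleftrightarrow>
     (\<exists>c>0. \<forall>n\<ge>3. \<forall>p\<in>{0<..1}. \<exists>A. C n A \<and> Vol n A > 0 \<and> Ov n A = p \<and>
        c * U n (Ov n A) \<le> expected_triangles n A)"

end

theory Submission
  imports Defs
begin

text \<open>
  Let \<open>m i j\<close> be the probability of the edge \<open>{i, j}\<close>. By linearity \<open>6 E[#triangles]\<close> is the sum of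
  \<open>P(i j k is a triangle)\<close> over ordered triples, and \<open>Ov = (\<Sum> m\<^sup>2) / Vol\<close>, so Cauchy--Schwarz gives
  \<open>2 Vol \<le> n\<^sup>2 Ov\<close>. Edge independence factors the triangle probability as \<open>w i j * w j k * w i k\<close>
  with \<open>w = m\<close>; for node independent models the Loomis--Whitney inequality bounds it by such a product
  with \<open>w = sqrt m\<close>. In both cases two applications of Cauchy--Schwarz bound the square of the sum over
  triples by \<open>(\<Sum> w\<^sup>2)^3\<close>, which is \<open>(2 Ov Vol)^3\<close> or \<open>(2 Vol)^3\<close>. For arbitrary models the triangle
  probability is at most \<open>m i j\<close>, and the sum over triples is at most \<open>2 n Vol\<close>.
\<close>

section \<open>Edge means, overlap and triangle counts\<close>

text \<open>Replacing 2 Vol by n^2 Ov turns the two cubes into n^6 Ov^6 and n^6 Ov^3; this is where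
  the exponents 3 and 3/2 come from. Square roots are taken only at the very end, so the estimates
  stay polynomial. The obstacle is node independence: two edges of a triangle share an embedding, so
  the triangle probability does not factor over edges. Independence of the nodes does make it an
  integral over a product of three laws, with three factors that each miss one variable.
  Loomis--Whitney bounds this by L2 norms of the weights, and weights in [0, 1] have squared L2 norm
  at most the edge probability. In each of the three examples all triples of distinct nodes have the
  same triangle probability q, namely p^3, p^(3/2) and p. The expected count is then exactly q (n
  choose 3), and (n choose 3) >= (n/3)^3 gives the lower constant 1/27. The upper constant is 1/6
  throughout: the argument for arbitrary models also yields 1/6, from which the stated 1/2
  follows.\<close>

lemma finite_adj_matrices: "finite (adj_matrices n)"
proof (rule finite_subset)
  show "adj_matrices n \<subseteq> (\<lambda>R. adj_of n (\<lambda>i j. (i, j) \<in> R)) ` Pow ({1..n} \<times> {1..n})"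
  proof
    fix G assume G: "G \<in> adj_matrices n"
    have "G i j = adj_of n (\<lambda>i j. (i, j) \<in> {(i, j) \<in> {1..n} \<times> {1..n}. G i j = 1}) i j" for i j
    proof -
      have "G i j \<in> {0, 1}" "G i i = 0" "i \<notin> {1..n} \<or> j \<notin> {1..n} \<longrightarrow> G i j = 0"
        using G unfolding adj_matrices_def by blast+
      then show ?thesis
        by (auto simp: adj_of_def)
    qed
    then have "G = adj_of n (\<lambda>i j. (i, j) \<in> {(i, j) \<in> {1..n} \<times> {1..n}. G i j = 1})"
      by (intro ext)
    then show "G \<in> (\<lambda>R. adj_of n (\<lambda>i j. (i, j) \<in> R)) ` Pow ({1..n} \<times> {1..n})"
      by (rule image_eqI) blast
  qed
qed auto

lemma adj_matrices_sym: "G \<in> adj_matrices n \<Longrightarrow> G i j = G j i"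
  and adj_matrices_diag: "G \<in> adj_matrices n \<Longrightarrow> G i i = 0"
  and adj_matrices_01: "G \<in> adj_matrices n \<Longrightarrow> G i j = 0 \<or> G i j = 1"
  and adj_matrices_outside: "G \<in> adj_matrices n \<Longrightarrow> i \<notin> {1..n} \<or> j \<notin> {1..n} \<Longrightarrow> G i j = 0"
  unfolding adj_matrices_def by blast+

lemma adj_of_in_adj_matrices: "symp R \<Longrightarrow> adj_of n R \<in> adj_matrices n"
  unfolding adj_matrices_def adj_of_def by (auto dest: sympD)

lemma finite_node_pairs: "finite (node_pairs n)"
  by (rule finite_subset[of _ "{1..n} \<times> {1..n}"]) (auto simp: node_pairs_def)

lemma graph_modelD: "graph_model n A \<Longrightarrow> G \<in> set_pmf A \<Longrightarrow> G \<in> adj_matrices n"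
  unfolding graph_model_def by blast

text \<open>A model has finite support, so linearity and monotonicity of expectation apply to every
  real function of the graph.\<close>

lemma integrable_graph_model:
  fixes f :: "adj_matrix \<Rightarrow> real"
  shows "graph_model n A \<Longrightarrow> integrable (measure_pmf A) f"
  unfolding graph_model_def
  by (intro integrable_measure_pmf_finite finite_subset[OF _ finite_adj_matrices])

text \<open>Passes from the sums over i < j in the definitions to full double sums, the form in
  which Cauchy-Schwarz is applied. The square of indices splits into the pairs i < j, their mirror
  image and the diagonal.\<close>

lemma sum_node_pairs:
  fixes f :: "nat \<Rightarrow> nat \<Rightarrow> real"
  assumes sym: "\<And>i j. i \<in> {1..n} \<Longrightarrow> j \<in> {1..n} \<Longrightarrow> f i j = f j i"
    and diag: "\<And>i. i \<in> {1..n} \<Longrightarrow> f i i = 0"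
  shows "(\<Sum>i\<in>{1..n}. \<Sum>j\<in>{1..n}. f i j) = 2 * (\<Sum>(i, j)\<in>node_pairs n. f i j)"
proof -
  let ?D = "(\<lambda>i. (i, i)) ` {1..n}"
  have split: "{1..n} \<times> {1..n} = (node_pairs n \<union> prod.swap ` node_pairs n) \<union> ?D"
  proof (intro equalityI subsetI)
    fix x assume x: "x \<in> {1..n} \<times> {1..n}"
    obtain i j where [simp]: "x = (i, j)" by fastforce
    consider "i < j" | "i = j" | "j < i" by linarith
    then show "x \<in> (node_pairs n \<union> prod.swap ` node_pairs n) \<union> ?D"
    proof cases
      case 3
      then have "(j, i) \<in> node_pairs n" using x by (auto simp: node_pairs_def)
      then have "prod.swap (j, i) \<in> prod.swap ` node_pairs n" by (rule imageI)
      then show ?thesis by simp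
    qed (use x in \<open>auto simp: node_pairs_def\<close>)
  qed (auto simp: node_pairs_def)
  note fin = finite_node_pairs[of n]
  have disj: "(node_pairs n \<union> prod.swap ` node_pairs n) \<inter> ?D = {}" "node_pairs n \<inter> prod.swap ` node_pairs n = {}"
    by (auto simp: node_pairs_def)
  have "(\<Sum>i\<in>{1..n}. \<Sum>j\<in>{1..n}. f i j) = (\<Sum>(i, j)\<in>{1..n} \<times> {1..n}. f i j)"
    by (simp add: sum.cartesian_product)
  also have "\<dots> = (\<Sum>(i, j)\<in>node_pairs n \<union> prod.swap ` node_pairs n. f i j) + (\<Sum>(i, j)\<in>?D. f i j)"
    unfolding split
    by (rule sum.union_disjoint) (use fin disj in auto)
  also have "(\<Sum>(i, j)\<in>?D. f i j) = 0"
    by (rule sum.neutral) (use diag in auto)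
  also have "(\<Sum>(i, j)\<in>node_pairs n \<union> prod.swap ` node_pairs n. f i j) =
      (\<Sum>(i, j)\<in>node_pairs n. f i j) + (\<Sum>(i, j)\<in>prod.swap ` node_pairs n. f i j)"
    by (rule sum.union_disjoint) (use fin disj in auto)
  also have "(\<Sum>(i, j)\<in>prod.swap ` node_pairs n. f i j) = (\<Sum>(i, j)\<in>node_pairs n. f j i)"
    by (subst sum.reindex) (auto simp: case_prod_unfold)
  also have "\<dots> = (\<Sum>(i, j)\<in>node_pairs n. f i j)"
    by (rule sum.cong) (auto simp: node_pairs_def intro!: sym)
  finally show ?thesis by simp
qed

text \<open>Double counting: a summand is 1 exactly when the ordered triple spans a triangle, and
  the map from ordered triples to their underlying sets has fibres of size 6. Triples with a
  repeated node contribute 0 because the diagonal vanishes.\<close>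

lemma sum_triangles:
  assumes G: "G \<in> adj_matrices n"
  shows "(\<Sum>i\<in>{1..n}. \<Sum>j\<in>{1..n}. \<Sum>k\<in>{1..n}. G i j * G j k * G i k) = 6 * card (triangles n G)"
proof -
  let ?X = "{(i, j, k) \<in> {1..n} \<times> {1..n} \<times> {1..n}. G i j = 1 \<and> G j k = 1 \<and> G i k = 1}"
  let ?s = "\<lambda>(i, j, k). {i, j, k}"
  have finX: "finite ?X"
    by (rule finite_subset[of _ "{1..n} \<times> {1..n} \<times> {1..n}"]) auto
  have finT: "finite (triangles n G)"
    by (rule finite_subset[of _ "Pow {1..n}"]) (auto simp: triangles_def)
  have neq: "G i i = 1 \<longleftrightarrow> False" for i using adj_matrices_diag[OF G] by simp
  have "(\<Sum>i\<in>{1..n}. \<Sum>j\<in>{1..n}. \<Sum>k\<in>{1..n}. G i j * G j k * G i k)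
      = (\<Sum>(i, j, k)\<in>{1..n} \<times> {1..n} \<times> {1..n}. G i j * G j k * G i k)"
    by (simp add: sum.cartesian_product)
  also have "\<dots> = (\<Sum>(i, j, k)\<in>?X. G i j * G j k * G i k)"
  proof (rule sum.mono_neutral_right)
    show "\<forall>x\<in>{1..n} \<times> {1..n} \<times> {1..n} - ?X. (case x of (i, j, k) \<Rightarrow> G i j * G j k * G i k) = 0"
    proof
      fix x assume x: "x \<in> {1..n} \<times> {1..n} \<times> {1..n} - ?X"
      obtain i j k where [simp]: "x = (i, j, k)" by (cases x)
      show "(case x of (i, j, k) \<Rightarrow> G i j * G j k * G i k) = 0"
        using x adj_matrices_01[OF G, of i j] adj_matrices_01[OF G, of j k] adj_matrices_01[OF G, of i k]
        by auto
    qed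
  qed auto
  also have "\<dots> = card ?X"
    by (subst card_eq_sum) (rule sum.cong, auto)
  also have "\<dots> = card (\<Union>T\<in>triangles n G. {x \<in> ?X. ?s x = T})"
  proof (rule arg_cong[of _ _ card], intro equalityI subsetI)
    fix x assume x: "x \<in> ?X"
    obtain i j k where [simp]: "x = (i, j, k)" by (cases x)
    have "i \<noteq> j" "j \<noteq> k" "i \<noteq> k"
      using x neq by auto
    then have "{i, j, k} \<in> triangles n G"
      using x adj_matrices_sym[OF G] unfolding triangles_def by auto
    then show "x \<in> (\<Union>T\<in>triangles n G. {x \<in> ?X. ?s x = T})"
      using x by auto
  qed auto
  also have "\<dots> = (\<Sum>T\<in>triangles n G. card {x \<in> ?X. ?s x = T})"
    by (rule card_UN_disjoint) (use finT finX in auto)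
  also have "\<dots> = (\<Sum>T\<in>triangles n G. 6)"
  proof (rule sum.cong[OF refl])
    fix T assume T: "T \<in> triangles n G"
    then obtain a b c where abc: "T = {a, b, c}" "a \<noteq> b" "b \<noteq> c" "a \<noteq> c"
      by (auto simp: triangles_def card_3_iff)
    have mem: "a \<in> {1..n}" "b \<in> {1..n}" "c \<in> {1..n}"
      and adj: "G a b = 1" "G b a = 1" "G a c = 1" "G c a = 1" "G b c = 1" "G c b = 1"
      using T abc by (auto simp: triangles_def)
    have "{x \<in> ?X. ?s x = T} = {(a,b,c), (a,c,b), (b,a,c), (b,c,a), (c,a,b), (c,b,a)}" (is "?L = ?R")
    proof (intro equalityI subsetI)
      fix x assume x: "x \<in> ?L"
      obtain i j k where [simp]: "x = (i, j, k)" by (cases x)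
      have "i \<noteq> j" "j \<noteq> k" "i \<noteq> k" using x neq by auto
      moreover have "{i, j, k} = {a, b, c}" using x abc by simp
      then have "i \<in> {a, b, c}" "j \<in> {a, b, c}" "k \<in> {a, b, c}" by blast+
      ultimately show "x \<in> ?R" by auto
    qed (use mem adj abc in auto)
    then show "card {x \<in> ?X. ?s x = T} = 6"
      using abc by simp
  qed
  finally show ?thesis by simp
qed

section \<open>Edge and triangle probabilities, volume and overlap\<close>

definition edge_mean :: "adj_matrix pmf \<Rightarrow> nat \<Rightarrow> nat \<Rightarrow> real" where
  "edge_mean A i j = measure_pmf.expectation A (\<lambda>G. real (G i j))"

text \<open>For adjacency matrices this is the probability that the three nodes form a triangle, and
  0 on degenerate triples. Writing it as an expectation over ordered triples lets linearity apply
  directly.\<close>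

definition triangle_mean :: "adj_matrix pmf \<Rightarrow> nat \<Rightarrow> nat \<Rightarrow> nat \<Rightarrow> real" where
  "triangle_mean A i j k = measure_pmf.expectation A (\<lambda>G. real (G i j * G j k * G i k))"

lemma edge_mean_nonneg: "0 \<le> edge_mean A i j"
  unfolding edge_mean_def by (rule Bochner_Integration.integral_nonneg) simp

lemma triangle_mean_nonneg: "0 \<le> triangle_mean A i j k"
  unfolding triangle_mean_def by (rule Bochner_Integration.integral_nonneg) simp

lemma expectation_cong:
  fixes f g :: "'a \<Rightarrow> real"
  assumes "\<And>x. x \<in> set_pmf A \<Longrightarrow> f x = g x"
  shows "measure_pmf.expectation A f = measure_pmf.expectation A g"
  by (rule integral_cong_AE) (auto simp: AE_measure_pmf_iff assms)

lemma expectation_mono: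
  fixes f g :: "adj_matrix \<Rightarrow> real"
  assumes "graph_model n A" "\<And>G. G \<in> adj_matrices n \<Longrightarrow> f G \<le> g G"
  shows "measure_pmf.expectation A f \<le> measure_pmf.expectation A g"
  by (rule integral_mono_AE)
     (auto simp: AE_measure_pmf_iff assms integrable_graph_model[OF assms(1)] graph_modelD[OF assms(1)])

lemma edge_mean_sym: "graph_model n A \<Longrightarrow> edge_mean A i j = edge_mean A j i"
  unfolding edge_mean_def
  by (rule expectation_cong) (metis graph_modelD adj_matrices_sym)

lemma edge_mean_diag:
  assumes "graph_model n A" shows "edge_mean A i i = 0"
proof -
  have "edge_mean A i i = measure_pmf.expectation A (\<lambda>_. 0)"
    unfolding edge_mean_def
    by (rule expectation_cong) (use adj_matrices_diag graph_modelD[OF assms] in auto)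
  then show ?thesis by simp
qed

lemma triangle_mean_diag:
  assumes "graph_model n A" "\<not> (i \<noteq> j \<and> j \<noteq> k \<and> i \<noteq> k)" shows "triangle_mean A i j k = 0"
proof -
  have "triangle_mean A i j k = measure_pmf.expectation A (\<lambda>_. 0)"
    unfolding triangle_mean_def
  proof (rule expectation_cong)
    fix G assume "G \<in> set_pmf A"
    note diag = adj_matrices_diag[OF graph_modelD[OF assms(1) this]]
    show "real (G i j * G j k * G i k) = 0"
      using assms(2) diag[of i] diag[of j] by auto
  qed
  then show ?thesis by simp
qed

lemma triangle_mean_le_edge_mean:
  assumes "graph_model n A" shows "triangle_mean A i j k \<le> edge_mean A i j"
  unfolding triangle_mean_def edge_mean_def
proof (rule expectation_mono[OF assms])
  fix G assume "G \<in> adj_matrices n"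
  from adj_matrices_01[OF this, of i j] adj_matrices_01[OF this, of j k] adj_matrices_01[OF this, of i k]
  show "real (G i j * G j k * G i k) \<le> real (G i j)" by auto
qed

lemma Vol_eq_sum:
  assumes "graph_model n A"
  shows "Vol n A = (\<Sum>(i, j)\<in>node_pairs n. edge_mean A i j)"
  unfolding Vol_def edge_mean_def
  by (subst Bochner_Integration.integral_sum)
     (auto simp: case_prod_unfold integrable_graph_model[OF assms])

lemma Vol_eq_sum2:
  assumes "graph_model n A"
  shows "2 * Vol n A = (\<Sum>i\<in>{1..n}. \<Sum>j\<in>{1..n}. edge_mean A i j)"
  unfolding Vol_eq_sum[OF assms]
  by (rule sum_node_pairs[symmetric]) (use edge_mean_sym[OF assms] edge_mean_diag[OF assms] in auto)

lemma expectation_pair_pmf_mult: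
  fixes f g :: "'a \<Rightarrow> real"
  assumes A: "finite (set_pmf A)"
  shows "measure_pmf.expectation (pair_pmf A A) (\<lambda>(x, y). f x * g y) =
    measure_pmf.expectation A f * measure_pmf.expectation A g"
proof -
  have "measure_pmf.expectation (pair_pmf A A) (\<lambda>(x, y). f x * g y) =
      (\<Sum>(x, y)\<in>set_pmf A \<times> set_pmf A. pmf A x * pmf A y * (f x * g y))"
    by (subst integral_measure_pmf[of "set_pmf A \<times> set_pmf A"])
       (auto simp: A pmf_pair case_prod_unfold intro!: sum.cong)
  also have "\<dots> = (\<Sum>x\<in>set_pmf A. pmf A x * f x) * (\<Sum>y\<in>set_pmf A. pmf A y * g y)"
    by (simp add: sum_product sum.cartesian_product mult_ac)
  also have "\<dots> = measure_pmf.expectation A f * measure_pmf.expectation A g"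
    by (simp add: integral_measure_pmf[OF A])
  finally show ?thesis .
qed

text \<open>The independence of the two samples turns the expected product at a pair into the square
  of the edge mean. Dependence between the edges of one sample does not enter, so the formula serves
  all three classes.\<close>

lemma Ov_eq_sum:
  assumes "graph_model n A"
  shows "Ov n A = (\<Sum>(i, j)\<in>node_pairs n. (edge_mean A i j)\<^sup>2) / Vol n A"
proof -
  have fin: "finite (set_pmf A)"
    using assms finite_adj_matrices finite_subset unfolding graph_model_def by blast
  have "measure_pmf.expectation (pair_pmf A A)
      (\<lambda>x. \<Sum>e\<in>node_pairs n. real (fst x (fst e) (snd e)) * real (snd x (fst e) (snd e)))
    = (\<Sum>e\<in>node_pairs n. measure_pmf.expectation (pair_pmf A A)
      (\<lambda>x. real (fst x (fst e) (snd e)) * real (snd x (fst e) (snd e))))"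
    by (rule Bochner_Integration.integral_sum) (auto intro!: integrable_measure_pmf_finite simp: fin)
  also have "\<dots> = (\<Sum>e\<in>node_pairs n. (edge_mean A (fst e) (snd e))\<^sup>2)"
    using expectation_pair_pmf_mult[OF fin, where f = "\<lambda>G. real (G _ _)" and g = "\<lambda>G. real (G _ _)"]
    unfolding case_prod_unfold by (simp add: edge_mean_def power2_eq_square)
  finally show ?thesis
    unfolding Ov_def by (simp add: case_prod_unfold)
qed

lemma Ov_Vol_eq_sum2:
  assumes "graph_model n A" "Vol n A > 0"
  shows "2 * (Ov n A * Vol n A) = (\<Sum>i\<in>{1..n}. \<Sum>j\<in>{1..n}. (edge_mean A i j)\<^sup>2)"
proof -
  have "(\<Sum>i\<in>{1..n}. \<Sum>j\<in>{1..n}. (edge_mean A i j)\<^sup>2) = 2 * (\<Sum>(i, j)\<in>node_pairs n. (edge_mean A i j)\<^sup>2)"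
    by (rule sum_node_pairs)
       (use edge_mean_sym[OF assms(1)] edge_mean_diag[OF assms(1)] in auto)
  then show ?thesis
    using assms by (simp add: Ov_eq_sum)
qed

lemma Ov_nonneg:
  assumes "graph_model n A" shows "0 \<le> Ov n A"
  unfolding Ov_eq_sum[OF assms] Vol_eq_sum[OF assms]
  by (intro divide_nonneg_nonneg sum_nonneg) (auto simp: edge_mean_nonneg)

text \<open>Cauchy-Schwarz against the constant 1 over all n^2 ordered pairs gives (2 Vol)^2 \<le> 2
  Ov Vol n^2, and the positive factor 2 Vol cancels. Keeping the diagonal pairs in the count makes
  the factor exactly n^2.\<close>

lemma Vol_le_Ov:
  assumes "graph_model n A" "Vol n A > 0"
  shows "2 * Vol n A \<le> (real n)\<^sup>2 * Ov n A"
proof -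
  let ?S = "{1..n} \<times> {1..n}"
  have "(2 * Vol n A)\<^sup>2 = (\<Sum>(i, j)\<in>?S. edge_mean A i j * 1)\<^sup>2"
    by (simp add: Vol_eq_sum2[OF assms(1)] sum.cartesian_product)
  also have "\<dots> \<le> (\<Sum>(i, j)\<in>?S. (edge_mean A i j)\<^sup>2) * (\<Sum>(i, j)\<in>?S. 1\<^sup>2)"
    using Cauchy_Schwarz_ineq_sum[of "\<lambda>x. edge_mean A (fst x) (snd x)" "\<lambda>x. 1" ?S]
    by (simp add: case_prod_unfold)
  also have "\<dots> = 2 * (Ov n A * Vol n A) * (real n)\<^sup>2"
    by (simp add: Ov_Vol_eq_sum2[OF assms] sum.cartesian_product power2_eq_square)
  finally have "(2 * Vol n A) * (2 * Vol n A) \<le> ((real n)\<^sup>2 * Ov n A) * (2 * Vol n A)"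
    by (simp add: power2_eq_square mult_ac)
  then show ?thesis
    using assms(2) by (simp add: mult.commute)
qed

lemma expected_triangles_eq_sum:
  assumes "graph_model n A"
  shows "6 * expected_triangles n A =
    (\<Sum>i\<in>{1..n}. \<Sum>j\<in>{1..n}. \<Sum>k\<in>{1..n}. triangle_mean A i j k)"
proof -
  have "6 * expected_triangles n A = measure_pmf.expectation A (\<lambda>G. real (6 * card (triangles n G)))"
    unfolding expected_triangles_def by simp
  also have "\<dots> = measure_pmf.expectation A
      (\<lambda>G. \<Sum>i\<in>{1..n}. \<Sum>j\<in>{1..n}. \<Sum>k\<in>{1..n}. real (G i j * G j k * G i k))"
    by (rule expectation_cong)
       (simp only: sum_triangles[OF graph_modelD[OF assms], symmetric] of_nat_sum)
  also have "\<dots> = (\<Sum>i\<in>{1..n}. \<Sum>j\<in>{1..n}. \<Sum>k\<in>{1..n}. triangle_mean A i j k)"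
    unfolding triangle_mean_def
    by (simp add: Bochner_Integration.integral_sum integrable_graph_model[OF assms] del: of_nat_mult)
  finally show ?thesis .
qed

section \<open>Models with constant edge and triangle probabilities\<close>

lemma triangles_complete:
  "triangles n (adj_of n (\<lambda>i j. True)) = {T. T \<subseteq> {1..n} \<and> card T = 3}"
  unfolding triangles_def adj_of_def by fastforce

lemma expected_triangles_uniform:
  assumes A: "graph_model n A"
    and q: "\<And>i j k. i \<in> {1..n} \<Longrightarrow> j \<in> {1..n} \<Longrightarrow> k \<in> {1..n} \<Longrightarrow> i \<noteq> j \<Longrightarrow> j \<noteq> k \<Longrightarrow> i \<noteq> k \<Longrightarrow>
      triangle_mean A i j k = q"
  shows "expected_triangles n A = q * real (n choose 3)"
proof -
  \<comment> \<open>The number of ordered triples of distinct nodes is read off the triangle count of the complete graph.\<close>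
  let ?K = "adj_of n (\<lambda>i j. True)"
  have K: "?K \<in> adj_matrices n"
    by (rule adj_of_in_adj_matrices) (auto simp: symp_def)
  have "6 * expected_triangles n A =
      (\<Sum>i\<in>{1..n}. \<Sum>j\<in>{1..n}. \<Sum>k\<in>{1..n}. triangle_mean A i j k)"
    by (rule expected_triangles_eq_sum[OF A])
  also have "\<dots> = (\<Sum>i\<in>{1..n}. \<Sum>j\<in>{1..n}. \<Sum>k\<in>{1..n}. q * real (?K i j * ?K j k * ?K i k))"
  proof (intro sum.cong refl)
    fix i j k assume "i \<in> {1..n}" "j \<in> {1..n}" "k \<in> {1..n}"
    then show "triangle_mean A i j k = q * real (?K i j * ?K j k * ?K i k)"
      using q[of i j k] triangle_mean_diag[OF A, of i j k] by (auto simp: adj_of_def)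
  qed
  also have "\<dots> = q * real (\<Sum>i\<in>{1..n}. \<Sum>j\<in>{1..n}. \<Sum>k\<in>{1..n}. ?K i j * ?K j k * ?K i k)"
    by (simp add: sum_distrib_left)
  also have "\<dots> = q * (6 * real (n choose 3))"
    unfolding sum_triangles[OF K] triangles_complete by (simp add: n_subsets)
  finally show ?thesis by simp
qed

text \<open>With N pairs of common mean p the overlap is N p^2 / (N p). Since n \<ge> 2 there is at
  least one pair, so this is a genuine quotient and not a division by zero.\<close>

lemma Vol_Ov_uniform:
  assumes A: "graph_model n A" and "p > 0" "n \<ge> 2"
    and p: "\<And>i j. (i, j) \<in> node_pairs n \<Longrightarrow> edge_mean A i j = p"
  shows "Vol n A > 0" "Ov n A = p"
proof -
  have V: "Vol n A = real (card (node_pairs n)) * p"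
    unfolding Vol_eq_sum[OF A] using p by (subst sum.cong[of _ _ _ "\<lambda>_. p"]) auto
  have O: "(\<Sum>(i, j)\<in>node_pairs n. (edge_mean A i j)\<^sup>2) = real (card (node_pairs n)) * p\<^sup>2"
    using p by (subst sum.cong[of _ _ _ "\<lambda>_. p\<^sup>2"]) auto
  have "(1, 2) \<in> node_pairs n" using \<open>n \<ge> 2\<close> by (auto simp: node_pairs_def)
  then have c: "card (node_pairs n) > 0"
    using finite_node_pairs by (auto simp: card_gt_0_iff)
  then show "Vol n A > 0" using V \<open>p > 0\<close> by simp
  show "Ov n A = p"
    unfolding Ov_eq_sum[OF A] O V using c \<open>p > 0\<close> by (simp add: power2_eq_square)
qed

text \<open>For symmetric \<open>w\<close> this is the matrix inequality (tr W^3)^2 \<le> (tr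
  W^2)^3, a discrete Loomis--Whitney inequality. The first Cauchy-Schwarz step separates
  \<open>w i j\<close> from the sum \<open>?v i j\<close> over the third node.\<close>

lemma sum_triple_product_le:
  fixes w :: "'a \<Rightarrow> 'a \<Rightarrow> real"
  shows "(\<Sum>i\<in>S. \<Sum>j\<in>S. \<Sum>k\<in>S. w i j * w j k * w i k)\<^sup>2 \<le> (\<Sum>i\<in>S. \<Sum>j\<in>S. (w i j)\<^sup>2) ^ 3"
proof -
  let ?F = "\<Sum>i\<in>S. \<Sum>j\<in>S. (w i j)\<^sup>2"
  let ?v = "\<lambda>i j. \<Sum>k\<in>S. w j k * w i k"
  let ?r = "\<lambda>i. \<Sum>k\<in>S. (w i k)\<^sup>2"
  have "(\<Sum>i\<in>S. \<Sum>j\<in>S. \<Sum>k\<in>S. w i j * w j k * w i k)\<^sup>2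
      = (\<Sum>(i, j)\<in>S \<times> S. w i j * ?v i j)\<^sup>2"
    by (simp add: sum.cartesian_product[symmetric] sum_distrib_left mult_ac)
  also have "\<dots> \<le> (\<Sum>(i, j)\<in>S \<times> S. (w i j)\<^sup>2) * (\<Sum>(i, j)\<in>S \<times> S. (?v i j)\<^sup>2)"
    using Cauchy_Schwarz_ineq_sum[of "\<lambda>x. w (fst x) (snd x)" "\<lambda>x. ?v (fst x) (snd x)" "S \<times> S"]
    by (simp add: case_prod_unfold)
  \<comment> \<open>The second Cauchy-Schwarz step, for each fixed pair: \<open>?v i j\<close> is
    the inner product of rows \<open>j\<close> and \<open>i\<close>. The bound is a product of a
    function of \<open>j\<close> and a function of \<open>i\<close>, so its double sum
    factors.\<close>
  also have "\<dots> \<le> (\<Sum>(i, j)\<in>S \<times> S. (w i j)\<^sup>2) * (\<Sum>(i, j)\<in>S \<times> S. ?r j * ?r i)"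
    by (intro mult_left_mono sum_mono sum_nonneg) (auto intro: Cauchy_Schwarz_ineq_sum)
  also have "(\<Sum>(i, j)\<in>S \<times> S. ?r j * ?r i) = ?F * ?F"
    by (simp add: sum.cartesian_product[symmetric] sum_product mult_ac)
  also have "(\<Sum>(i, j)\<in>S \<times> S. (w i j)\<^sup>2) = ?F"
    by (simp add: sum.cartesian_product)
  finally show ?thesis by (simp add: power3_eq_cube mult_ac)
qed

text \<open>Common end of the edge and node independent cases, to be used with \<open>w\<close> the
  edge mean or its square root. A bound on triples of distinct nodes suffices, since the others have
  triangle mean 0 and \<open>w\<close> is nonnegative.\<close>

lemma expected_triangles_squared_le:
  assumes A: "graph_model n A"
    and w: "\<And>i j. 0 \<le> w i j"
    and le: "\<And>i j k. i \<in> {1..n} \<Longrightarrow> j \<in> {1..n} \<Longrightarrow> k \<in> {1..n} \<Longrightarrow> i \<noteq> j \<Longrightarrow> j \<noteq> k \<Longrightarrow> i \<noteq> k \<Longrightarrow>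
      triangle_mean A i j k \<le> w i j * w j k * w i k"
  shows "(6 * expected_triangles n A)\<^sup>2 \<le> (\<Sum>i\<in>{1..n}. \<Sum>j\<in>{1..n}. (w i j)\<^sup>2) ^ 3"
proof -
  have "6 * expected_triangles n A \<le> (\<Sum>i\<in>{1..n}. \<Sum>j\<in>{1..n}. \<Sum>k\<in>{1..n}. w i j * w j k * w i k)"
    unfolding expected_triangles_eq_sum[OF A]
  proof (intro sum_mono)
    fix i j k assume "i \<in> {1..n}" "j \<in> {1..n}" "k \<in> {1..n}"
    then show "triangle_mean A i j k \<le> w i j * w j k * w i k"
      using le[of i j k] triangle_mean_diag[OF A, of i j k] w by fastforce
  qed
  moreover have "0 \<le> 6 * expected_triangles n A"
    unfolding expected_triangles_eq_sum[OF A] by (intro sum_nonneg triangle_mean_nonneg)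
  ultimately have "(6 * expected_triangles n A)\<^sup>2 \<le>
      (\<Sum>i\<in>{1..n}. \<Sum>j\<in>{1..n}. \<Sum>k\<in>{1..n}. w i j * w j k * w i k)\<^sup>2"
    by (rule power_mono)
  then show ?thesis
    using sum_triple_product_le order_trans by blast
qed

text \<open>A triangle is present only if its first edge is, and the free third node costs a factor
  n. The 6 orderings of a triangle are kept in the count, which makes the constant 1/6.\<close>

lemma fully_dependent_triangles_le:
  assumes A: "graph_model n A" "Vol n A > 0"
  shows "expected_triangles n A \<le> 1/6 * real n ^ 3 * Ov n A"
proof -
  have "6 * expected_triangles n A \<le> (\<Sum>i\<in>{1..n}. \<Sum>j\<in>{1..n}. \<Sum>k\<in>{1..n}. edge_mean A i j)"
    unfolding expected_triangles_eq_sum[OF A(1)]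
    by (intro sum_mono triangle_mean_le_edge_mean[OF A(1)])
  also have "\<dots> = real n * (2 * Vol n A)"
    by (simp add: Vol_eq_sum2[OF A(1)] sum_distrib_left)
  also have "\<dots> \<le> real n * ((real n)\<^sup>2 * Ov n A)"
    by (intro mult_left_mono Vol_le_Ov A) simp
  finally show ?thesis by (simp add: power2_eq_square power3_eq_cube)
qed

section \<open>A Loomis--Whitney inequality for independent variables\<close>

text \<open>The continuous counterpart of \<open>sum_triple_product_le\<close>, with three functions
  on three spaces because the embeddings of different nodes may have different laws. Nonnegative
  integrals keep Tonelli free of integrability conditions.\<close>

lemma loomis_whitney_nn_integral:
  assumes "sigma_finite_measure A" "sigma_finite_measure B" "sigma_finite_measure C"
  assumes f [measurable]: "case_prod f \<in> borel_measurable (A \<Otimes>\<^sub>M B)"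
    and g [measurable]: "case_prod g \<in> borel_measurable (B \<Otimes>\<^sub>M C)"
    and h [measurable]: "case_prod h \<in> borel_measurable (A \<Otimes>\<^sub>M C)"
  shows "(\<integral>\<^sup>+x. \<integral>\<^sup>+y. \<integral>\<^sup>+z. f x y * g y z * h x z \<partial>C \<partial>B \<partial>A)\<^sup>2 \<le>
    (\<integral>\<^sup>+x. \<integral>\<^sup>+y. (f x y)\<^sup>2 \<partial>B \<partial>A) * (\<integral>\<^sup>+y. \<integral>\<^sup>+z. (g y z)\<^sup>2 \<partial>C \<partial>B) *
    (\<integral>\<^sup>+x. \<integral>\<^sup>+z. (h x z)\<^sup>2 \<partial>C \<partial>A)"
proof -
  interpret A: sigma_finite_measure A by fact
  interpret B: sigma_finite_measure B by fact
  interpret C: sigma_finite_measure C by fact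
  \<comment> \<open>Integrating out the third variable leaves a pairing of \<open>f\<close> with
    \<open>k\<close> over the first two, ready for Cauchy-Schwarz; a second use in \<open>z\<close>
    bounds \<open>k\<close> itself.\<close>
  define k where "k x y = (\<integral>\<^sup>+z. g y z * h x z \<partial>C)" for x y
  have k [measurable]: "case_prod k \<in> borel_measurable (A \<Otimes>\<^sub>M B)"
    unfolding k_def by measurable
  have k_le: "(k x y)\<^sup>2 \<le> (\<integral>\<^sup>+z. (h x z)\<^sup>2 \<partial>C) * (\<integral>\<^sup>+z. (g y z)\<^sup>2 \<partial>C)"
    if "x \<in> space A" "y \<in> space B" for x y
    unfolding k_def mult.commute[of "g y _"]
    by (rule Cauchy_Schwarz_nn_integral) (use that in measurable)
  have "(\<integral>\<^sup>+x. \<integral>\<^sup>+y. \<integral>\<^sup>+z. f x y * g y z * h x z \<partial>C \<partial>B \<partial>A) = (\<integral>\<^sup>+x. \<integral>\<^sup>+y. f x y * k x y \<partial>B \<partial>A)"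
    unfolding k_def mult.assoc
    by (intro nn_integral_cong nn_integral_cmult) measurable
  also have "\<dots> = (\<integral>\<^sup>+w. case_prod f w * case_prod k w \<partial>(A \<Otimes>\<^sub>M B))"
    by (subst B.nn_integral_fst[symmetric]) auto
  finally have I: "(\<integral>\<^sup>+x. \<integral>\<^sup>+y. \<integral>\<^sup>+z. f x y * g y z * h x z \<partial>C \<partial>B \<partial>A)\<^sup>2 \<le>
      (\<integral>\<^sup>+w. (case_prod f w)\<^sup>2 \<partial>(A \<Otimes>\<^sub>M B)) * (\<integral>\<^sup>+w. (case_prod k w)\<^sup>2 \<partial>(A \<Otimes>\<^sub>M B))"
    using Cauchy_Schwarz_nn_integral[OF f k] by simp
  have f2: "(\<integral>\<^sup>+w. (case_prod f w)\<^sup>2 \<partial>(A \<Otimes>\<^sub>M B)) = (\<integral>\<^sup>+x. \<integral>\<^sup>+y. (f x y)\<^sup>2 \<partial>B \<partial>A)"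
    by (subst B.nn_integral_fst[symmetric]) auto
  have "(\<integral>\<^sup>+w. (case_prod k w)\<^sup>2 \<partial>(A \<Otimes>\<^sub>M B)) = (\<integral>\<^sup>+x. \<integral>\<^sup>+y. (k x y)\<^sup>2 \<partial>B \<partial>A)"
    by (subst B.nn_integral_fst[symmetric]) auto
  \<comment> \<open>The integrand is now a function of \<open>x\<close> times a function of
    \<open>y\<close>, so the double integral splits into a product.\<close>
  also have "\<dots> \<le> (\<integral>\<^sup>+x. \<integral>\<^sup>+y. (\<integral>\<^sup>+z. (h x z)\<^sup>2 \<partial>C) * (\<integral>\<^sup>+z. (g y z)\<^sup>2 \<partial>C) \<partial>B \<partial>A)"
    by (intro nn_integral_mono k_le)
  also have "\<dots> = (\<integral>\<^sup>+x. (\<integral>\<^sup>+z. (h x z)\<^sup>2 \<partial>C) * (\<integral>\<^sup>+y. \<integral>\<^sup>+z. (g y z)\<^sup>2 \<partial>C \<partial>B) \<partial>A)"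
    by (intro nn_integral_cong nn_integral_cmult) measurable
  also have "\<dots> = (\<integral>\<^sup>+x. \<integral>\<^sup>+z. (h x z)\<^sup>2 \<partial>C \<partial>A) * (\<integral>\<^sup>+y. \<integral>\<^sup>+z. (g y z)\<^sup>2 \<partial>C \<partial>B)"
    by (intro nn_integral_multc) measurable
  finally have "(\<integral>\<^sup>+w. (case_prod k w)\<^sup>2 \<partial>(A \<Otimes>\<^sub>M B)) \<le> \<dots>" .
  from order_trans[OF I mult_left_mono[OF this]] show ?thesis
    unfolding f2 by (simp add: mult_ac)
qed

text \<open>Disjoint index blocks of an independent family are independent; here the blocks are
  singletons, and projecting out of the one-point product spaces gives the claim in
  \<open>E\<close>.\<close>

lemma (in prob_space) indep_vars_pair_distr:
  assumes indep: "indep_vars (\<lambda>_. E) x I" and ij: "i \<in> I" "j \<in> I" "i \<noteq> j"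
  shows "distr M (E \<Otimes>\<^sub>M E) (\<lambda>\<omega>. (x i \<omega>, x j \<omega>)) = distr M E (x i) \<Otimes>\<^sub>M distr M E (x j)"
proof -
  have "indep_var (PiM {i} (\<lambda>_. E)) (\<lambda>\<omega>. restrict (\<lambda>i. x i \<omega>) {i})
      (PiM {j} (\<lambda>_. E)) (\<lambda>\<omega>. restrict (\<lambda>i. x i \<omega>) {j})"
    by (rule indep_var_restrict[OF indep]) (use ij in auto)
  then have "indep_var E ((\<lambda>f. f i) \<circ> (\<lambda>\<omega>. restrict (\<lambda>i. x i \<omega>) {i}))
      E ((\<lambda>f. f j) \<circ> (\<lambda>\<omega>. restrict (\<lambda>i. x i \<omega>) {j}))"
    by (rule indep_var_compose) measurable
  then show ?thesis
    unfolding indep_var_distribution_eq by (simp add: comp_def)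
qed

text \<open>Splits the indices into the blocks {i} and {j, k}, then treats the second block by the
  pair case. The right-nested product is the shape that unfolds into the iterated integral of
  Loomis--Whitney.\<close>

lemma (in prob_space) indep_vars_triple_distr:
  assumes indep: "indep_vars (\<lambda>_. E) x I"
    and ijk: "i \<in> I" "j \<in> I" "k \<in> I" "i \<noteq> j" "j \<noteq> k" "i \<noteq> k"
  shows "distr M (E \<Otimes>\<^sub>M (E \<Otimes>\<^sub>M E)) (\<lambda>\<omega>. (x i \<omega>, x j \<omega>, x k \<omega>)) =
    distr M E (x i) \<Otimes>\<^sub>M (distr M E (x j) \<Otimes>\<^sub>M distr M E (x k))"
proof -
  let ?u = "\<lambda>\<omega>. restrict (\<lambda>i. x i \<omega>) {i}" and ?v = "\<lambda>\<omega>. restrict (\<lambda>i. x i \<omega>) {j, k}"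
  have "indep_var (PiM {i} (\<lambda>_. E)) ?u (PiM {j, k} (\<lambda>_. E)) ?v"
    by (rule indep_var_restrict[OF indep]) (use ijk in auto)
  then have eq: "distr M (PiM {i} (\<lambda>_. E)) ?u \<Otimes>\<^sub>M distr M (PiM {j, k} (\<lambda>_. E)) ?v =
      distr M (PiM {i} (\<lambda>_. E) \<Otimes>\<^sub>M PiM {j, k} (\<lambda>_. E)) (\<lambda>\<omega>. (?u \<omega>, ?v \<omega>))"
    and [measurable]: "?u \<in> measurable M (PiM {i} (\<lambda>_. E))" "?v \<in> measurable M (PiM {j, k} (\<lambda>_. E))"
    unfolding indep_var_distribution_eq by simp_all
  \<comment> \<open>Supplies the sigma-finiteness of the second factor that
    \<open>pair_measure_distr\<close> asks for.\<close>
  interpret jk: prob_space "distr (distr M (PiM {j, k} (\<lambda>_. E)) ?v) (E \<Otimes>\<^sub>M E) (\<lambda>f. (f j, f k))"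
    by (intro prob_space.prob_space_distr prob_space_distr) measurable
  have "distr M E (x i) \<Otimes>\<^sub>M distr M (E \<Otimes>\<^sub>M E) (\<lambda>\<omega>. (x j \<omega>, x k \<omega>)) =
      distr (distr M (PiM {i} (\<lambda>_. E)) ?u) E (\<lambda>f. f i) \<Otimes>\<^sub>M
      distr (distr M (PiM {j, k} (\<lambda>_. E)) ?v) (E \<Otimes>\<^sub>M E) (\<lambda>f. (f j, f k))"
    by (simp add: distr_distr comp_def)
  also have "\<dots> = distr (distr M (PiM {i} (\<lambda>_. E)) ?u \<Otimes>\<^sub>M distr M (PiM {j, k} (\<lambda>_. E)) ?v)
      (E \<Otimes>\<^sub>M (E \<Otimes>\<^sub>M E)) (\<lambda>(f, g). (f i, g j, g k))"
    by (rule pair_measure_distr) (measurable, unfold_locales)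
  also have "\<dots> = distr M (E \<Otimes>\<^sub>M (E \<Otimes>\<^sub>M E)) (\<lambda>\<omega>. (x i \<omega>, x j \<omega>, x k \<omega>))"
    unfolding eq by (simp add: distr_distr comp_def)
  finally show ?thesis
    using indep_vars_pair_distr[OF indep ijk(2,3,5)] by simp
qed

text \<open>The joint law of independent embeddings is a product measure, so every integral over
  \<open>M\<close> becomes an iterated integral over the marginal laws \<open>D\<close>, to which
  the inequality for product spaces applies.\<close>

lemma (in prob_space) indep_vars_loomis_whitney:
  assumes indep: "indep_vars (\<lambda>_. E) x I"
    and ijk: "i \<in> I" "j \<in> I" "k \<in> I" "i \<noteq> j" "j \<noteq> k" "i \<noteq> k"
    and f [measurable]: "case_prod f \<in> borel_measurable (E \<Otimes>\<^sub>M E)"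
  shows "(\<integral>\<^sup>+\<omega>. f (x i \<omega>) (x j \<omega>) * f (x j \<omega>) (x k \<omega>) * f (x i \<omega>) (x k \<omega>) \<partial>M)\<^sup>2 \<le>
    (\<integral>\<^sup>+\<omega>. (f (x i \<omega>) (x j \<omega>))\<^sup>2 \<partial>M) * (\<integral>\<^sup>+\<omega>. (f (x j \<omega>) (x k \<omega>))\<^sup>2 \<partial>M) *
    (\<integral>\<^sup>+\<omega>. (f (x i \<omega>) (x k \<omega>))\<^sup>2 \<partial>M)"
proof -
  have x [measurable]: "a \<in> I \<Longrightarrow> x a \<in> measurable M E" for a
    using indep unfolding indep_vars_def by auto
  note x_ijk [measurable] = x[OF ijk(1)] x[OF ijk(2)] x[OF ijk(3)]
  define D where "D a = distr M E (x a)" for a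
  have [measurable_cong, simp]: "sets (D a) = sets E" and space_D: "space (D a) = space E" for a
    by (simp_all add: D_def)
  have sf: "sigma_finite_measure (D a)" if "a \<in> I" for a
    unfolding D_def using prob_space_distr[OF x[OF that]] prob_space_imp_sigma_finite by blast
  note sfs = sf[OF ijk(1)] sf[OF ijk(2)] sf[OF ijk(3)]
  have pair: "(\<integral>\<^sup>+\<omega>. (f (x a \<omega>) (x b \<omega>))\<^sup>2 \<partial>M) = (\<integral>\<^sup>+u. \<integral>\<^sup>+v. (f u v)\<^sup>2 \<partial>D b \<partial>D a)"
    if ab: "a \<in> I" "b \<in> I" "a \<noteq> b" for a b
  proof -
    interpret b: sigma_finite_measure "D b" by (rule sf) fact
    note [measurable] = x[OF ab(1)] x[OF ab(2)]
    have "(\<integral>\<^sup>+\<omega>. (f (x a \<omega>) (x b \<omega>))\<^sup>2 \<partial>M) =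
        (\<integral>\<^sup>+w. (case_prod f w)\<^sup>2 \<partial>distr M (E \<Otimes>\<^sub>M E) (\<lambda>\<omega>. (x a \<omega>, x b \<omega>)))"
      by (subst nn_integral_distr) simp_all
    also have "\<dots> = (\<integral>\<^sup>+u. \<integral>\<^sup>+v. (f u v)\<^sup>2 \<partial>D b \<partial>D a)"
      unfolding indep_vars_pair_distr[OF indep ab] D_def[symmetric]
      by (subst b.nn_integral_fst[symmetric]) simp_all
    finally show ?thesis .
  qed
  interpret j: sigma_finite_measure "D j" by (rule sf) fact
  interpret k: sigma_finite_measure "D k" by (rule sf) fact
  interpret jk: pair_sigma_finite "D j" "D k" ..
  have "(\<integral>\<^sup>+\<omega>. f (x i \<omega>) (x j \<omega>) * f (x j \<omega>) (x k \<omega>) * f (x i \<omega>) (x k \<omega>) \<partial>M) =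
      (\<integral>\<^sup>+(u, v, w). f u v * f v w * f u w
        \<partial>distr M (E \<Otimes>\<^sub>M (E \<Otimes>\<^sub>M E)) (\<lambda>\<omega>. (x i \<omega>, x j \<omega>, x k \<omega>)))"
    by (subst nn_integral_distr) simp_all
  also have "\<dots> = (\<integral>\<^sup>+u. \<integral>\<^sup>+v. \<integral>\<^sup>+w. f u v * f v w * f u w \<partial>D k \<partial>D j \<partial>D i)"
    unfolding indep_vars_triple_distr[OF indep ijk] D_def[symmetric]
    by (subst jk.nn_integral_fst[symmetric], measurable, intro nn_integral_cong,
        subst k.nn_integral_fst[symmetric]) (simp_all add: space_D, measurable)
  finally show ?thesis
    using loomis_whitney_nn_integral[OF sfs, of f f f] pair ijk by simp
qed

section \<open>Edge independent models\<close>

text \<open>In a discrete space every set is an event, so independence is the product formula for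
  all choices of \<open>B\<close>. The full index set is enough: choosing \<open>B i\<close> as the
  whole space removes the index \<open>i\<close>.\<close>

lemma indep_vars_measure_pmf_iff:
  assumes "finite I"
  shows "prob_space.indep_vars (measure_pmf A) (\<lambda>_. count_space UNIV) X I \<longleftrightarrow>
    (\<forall>B. measure_pmf.prob A {a. \<forall>i\<in>I. X i a \<in> B i} = (\<Prod>i\<in>I. measure_pmf.prob A {a. X i a \<in> B i}))"
proof (cases "I = {}")
  case True
  then show ?thesis
    by (simp add: prob_space.indep_vars_def prob_space.indep_sets_def measure_pmf.prob_space_axioms)
next
  case False
  have sig: "sets (count_space UNIV) = sigma_sets (space (count_space UNIV)) UNIV"
    by (auto intro: sigma_sets.Basic)
  have "prob_space.indep_vars (measure_pmf A) (\<lambda>_. count_space UNIV) X I \<longleftrightarrow>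
    (\<forall>B\<in>I \<rightarrow> UNIV. measure_pmf.prob A (\<Inter>i\<in>I. X i -` B i \<inter> space A) =
      (\<Prod>i\<in>I. measure_pmf.prob A (X i -` B i \<inter> space A)))"
    by (rule prob_space.indep_vars_finite[OF measure_pmf.prob_space_axioms False assms sig])
       (auto simp: Int_stable_def)
  moreover have "(\<Inter>i\<in>I. X i -` B i) = {a. \<forall>i\<in>I. X i a \<in> B i}" for B
    by auto
  ultimately show ?thesis
    by (simp add: vimage_def Pi_def)
qed

lemma indep_vars_map_pmf_iff:
  assumes "finite I"
  shows "prob_space.indep_vars (measure_pmf (map_pmf f A)) (\<lambda>_. count_space UNIV) X I \<longleftrightarrow>
    prob_space.indep_vars (measure_pmf A) (\<lambda>_. count_space UNIV) (\<lambda>i a. X i (f a)) I"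
  unfolding indep_vars_measure_pmf_iff[OF assms] by (simp add: vimage_def)

lemma indep_vars_return_pmf:
  assumes "finite I"
  shows "prob_space.indep_vars (measure_pmf (return_pmf a)) (\<lambda>_. count_space UNIV) X I"
  unfolding indep_vars_measure_pmf_iff[OF assms] measure_return_pmf
  using assms by (induction I) (auto simp: indicator_def)

lemma indep_vars_measure_pmf_subset:
  assumes "finite I" "J \<subseteq> I"
    and "prob_space.indep_vars (measure_pmf A) (\<lambda>_. count_space UNIV) X I"
  shows "measure_pmf.prob A {a. \<forall>i\<in>J. X i a \<in> B i} = (\<Prod>i\<in>J. measure_pmf.prob A {a. X i a \<in> B i})"
  using prob_space.indep_vars_subset[OF measure_pmf.prob_space_axioms assms(3,2)] finite_subset[OF assms(2,1)]
    indep_vars_measure_pmf_iff by blast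

text \<open>The representative in \<open>node_pairs\<close> of an undirected edge. Independence is
  stated for indices i < j only, while triangles are summed over triples in arbitrary order.\<close>

definition ordered_pair :: "nat \<Rightarrow> nat \<Rightarrow> nat \<times> nat" where
  "ordered_pair i j = (min i j, max i j)"

lemma ordered_pair_in_node_pairs:
  "i \<in> {1..n} \<Longrightarrow> j \<in> {1..n} \<Longrightarrow> i \<noteq> j \<Longrightarrow> ordered_pair i j \<in> node_pairs n"
  by (auto simp: ordered_pair_def node_pairs_def)

lemma ordered_pair_eq_iff: "ordered_pair i j = ordered_pair k l \<longleftrightarrow> {i, j} = {k, l}"
  unfolding ordered_pair_def by (auto simp: min_def max_def doubleton_eq_iff)

text \<open>The three sides of a nondegenerate triple are different undirected edges, so the product
  over the set of representatives really has three factors.\<close>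

lemma prod_ordered_pairs:
  fixes f :: "nat \<Rightarrow> nat \<Rightarrow> real"
  assumes "i \<noteq> j" "j \<noteq> k" "i \<noteq> k"
    and "f i j = f j i" "f j k = f k j" "f i k = f k i"
  shows "(\<Prod>e\<in>{ordered_pair i j, ordered_pair j k, ordered_pair i k}. f (fst e) (snd e)) =
    f i j * f j k * f i k"
proof -
  have "f (fst (ordered_pair a b)) (snd (ordered_pair a b)) = (if a \<le> b then f a b else f b a)" for a b
    by (simp add: ordered_pair_def min_def max_def)
  moreover have "ordered_pair i j \<notin> {ordered_pair j k, ordered_pair i k}" "ordered_pair j k \<notin> {ordered_pair i k}"
    using assms by (auto simp: ordered_pair_eq_iff doubleton_eq_iff)
  ultimately show ?thesis
    using assms by simp
qed

lemma edge_independent_withD: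
  assumes "edge_independent_with n P A"
  shows "graph_model n A"
    and "i \<in> {1..n} \<Longrightarrow> j \<in> {1..n} \<Longrightarrow> P i j = P j i"
    and "i \<in> {1..n} \<Longrightarrow> j \<in> {1..n} \<Longrightarrow> 0 \<le> P i j"
    and "i \<in> {1..n} \<Longrightarrow> j \<in> {1..n} \<Longrightarrow> P i j \<le> 1"
    and "(i, j) \<in> node_pairs n \<Longrightarrow> measure_pmf.prob A {G. G i j = 1} = P i j"
    and "prob_space.indep_vars (measure_pmf A) (\<lambda>_. count_space UNIV) (\<lambda>(i, j) G. G i j) (node_pairs n)"
  using assms unfolding edge_independent_with_def by auto

lemma expectation_prod_edges:
  assumes A: "graph_model n A" and "finite S"
  shows "measure_pmf.expectation A (\<lambda>G. \<Prod>e\<in>S. real (G (fst e) (snd e))) =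
    measure_pmf.prob A {G. \<forall>e\<in>S. G (fst e) (snd e) = 1}"
proof -
  have "measure_pmf.expectation A (\<lambda>G. \<Prod>e\<in>S. real (G (fst e) (snd e))) =
      measure_pmf.expectation A (indicator {G. \<forall>e\<in>S. G (fst e) (snd e) = 1})"
  proof (rule expectation_cong)
    fix G assume "G \<in> set_pmf A"
    then have "G i j = 0 \<or> G i j = 1" for i j
      using graph_modelD[OF A] adj_matrices_01 by blast
    with \<open>finite S\<close> show "(\<Prod>e\<in>S. real (G (fst e) (snd e))) = indicator {G. \<forall>e\<in>S. G (fst e) (snd e) = 1} G"
      by (induction S) (auto simp: indicator_def)
  qed
  then show ?thesis by simp
qed

text \<open>A product of 0/1 entries is the indicator that all edges of \<open>S\<close> are
  present, whose probability factors. One-element \<open>S\<close> yields edge means, the three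
  sides of a triangle yield triangle means.\<close>

lemma edge_independent_with_expectation_prod:
  assumes A: "edge_independent_with n P A" and S: "S \<subseteq> node_pairs n"
  shows "measure_pmf.expectation A (\<lambda>G. \<Prod>e\<in>S. real (G (fst e) (snd e))) = (\<Prod>e\<in>S. P (fst e) (snd e))"
proof -
  note AD = edge_independent_withD[OF A]
  have "measure_pmf.expectation A (\<lambda>G. \<Prod>e\<in>S. real (G (fst e) (snd e))) =
      measure_pmf.prob A {G. \<forall>e\<in>S. (case e of (i, j) \<Rightarrow> \<lambda>G. G i j) G \<in> {1}}"
    using expectation_prod_edges[OF AD(1) finite_subset[OF S finite_node_pairs]]
    by (simp add: case_prod_unfold)
  also have "\<dots> = (\<Prod>e\<in>S. measure_pmf.prob A {G. (case e of (i, j) \<Rightarrow> \<lambda>G. G i j) G \<in> {1}})"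
    by (rule indep_vars_measure_pmf_subset[OF finite_node_pairs S AD(6)])
  also have "\<dots> = (\<Prod>e\<in>S. P (fst e) (snd e))"
    by (rule prod.cong) (use S AD(5) in \<open>auto simp: case_prod_unfold\<close>)
  finally show ?thesis .
qed

lemma edge_independent_with_edge_mean:
  assumes A: "edge_independent_with n P A" and ij: "i \<in> {1..n}" "j \<in> {1..n}" "i \<noteq> j"
  shows "edge_mean A i j = P i j"
proof -
  note AD = edge_independent_withD[OF A]
  have *: "edge_mean A a b = P a b" if "(a, b) \<in> node_pairs n" for a b
    using edge_independent_with_expectation_prod[OF A, of "{(a, b)}"] that by (simp add: edge_mean_def)
  consider "i < j" | "j < i" using ij by linarith
  then show ?thesis
  proof cases
    case 1 then show ?thesis using * ij by (auto simp: node_pairs_def)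
  next
    case 2
    then have "edge_mean A j i = P j i" using * ij by (auto simp: node_pairs_def)
    then show ?thesis using edge_mean_sym[OF AD(1)] AD(2) ij by metis
  qed
qed

lemma edge_independent_with_triangle_mean:
  assumes A: "edge_independent_with n P A"
    and ijk: "i \<in> {1..n}" "j \<in> {1..n}" "k \<in> {1..n}" "i \<noteq> j" "j \<noteq> k" "i \<noteq> k"
  shows "triangle_mean A i j k = P i j * P j k * P i k"
proof -
  note AD = edge_independent_withD[OF A]
  let ?S = "{ordered_pair i j, ordered_pair j k, ordered_pair i k}"
  have "triangle_mean A i j k = measure_pmf.expectation A (\<lambda>G. \<Prod>e\<in>?S. real (G (fst e) (snd e)))"
    unfolding triangle_mean_def
  proof (rule expectation_cong)
    fix G assume "G \<in> set_pmf A"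
    then have "G \<in> adj_matrices n" by (rule graph_modelD[OF AD(1)])
    then show "real (G i j * G j k * G i k) = (\<Prod>e\<in>?S. real (G (fst e) (snd e)))"
      by (subst prod_ordered_pairs[OF ijk(4-6)]) (auto simp: adj_matrices_sym)
  qed
  also have "\<dots> = (\<Prod>e\<in>?S. P (fst e) (snd e))"
    by (rule edge_independent_with_expectation_prod[OF A])
       (use ijk ordered_pair_in_node_pairs in auto)
  also have "\<dots> = P i j * P j k * P i k"
    by (rule prod_ordered_pairs[OF ijk(4-6)]) (use AD(2) ijk in auto)
  finally show ?thesis .
qed

text \<open>Needed for node independent models: an explicit polynomial in the edge probabilities
  shows that the conditional law of the graph depends measurably on the embeddings.\<close>

lemma edge_independent_with_pmf:
  assumes A: "edge_independent_with n P A" and G: "G \<in> adj_matrices n"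
  shows "pmf A G = (\<Prod>(i, j)\<in>node_pairs n. if G i j = 1 then P i j else 1 - P i j)"
proof -
  note AD = edge_independent_withD[OF A]
  \<comment> \<open>The \<open>G\<close> bound by the inner abstraction is the argument
    \<open>H\<close>; only the \<open>G\<close> in the singleton is the fixed graph. By symmetry,
    zero diagonal and zero entries outside the node range, the entries with i < j determine a
    graph.\<close>
  have "pmf A G = measure_pmf.prob A {H. \<forall>e\<in>node_pairs n. (case e of (i, j) \<Rightarrow> \<lambda>G. G i j) H \<in> {G (fst e) (snd e)}}"
    unfolding pmf.rep_eq
  proof (rule measure_pmf.finite_measure_eq_AE; simp add: AE_measure_pmf_iff case_prod_unfold)
    show "\<forall>H\<in>set_pmf A. (H = G) = (\<forall>x\<in>node_pairs n. H (fst x) (snd x) = G (fst x) (snd x))"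
    proof
      fix H assume "H \<in> set_pmf A"
      then have H: "H \<in> adj_matrices n" by (rule graph_modelD[OF AD(1)])
      show "(H = G) = (\<forall>x\<in>node_pairs n. H (fst x) (snd x) = G (fst x) (snd x))"
      proof
        assume *: "\<forall>x\<in>node_pairs n. H (fst x) (snd x) = G (fst x) (snd x)"
        show "H = G"
        proof (intro ext)
          fix i j
          consider "i \<notin> {1..n} \<or> j \<notin> {1..n}" | "i = j" | "(i, j) \<in> node_pairs n" | "(j, i) \<in> node_pairs n"
            by (cases i j rule: linorder_cases) (auto simp: node_pairs_def)
          then show "H i j = G i j"
          proof cases
            case 4
            then show ?thesis
              using * adj_matrices_sym[OF H, of i j] adj_matrices_sym[OF G, of i j] by auto
          qed (use * adj_matrices_outside[OF H] adj_matrices_outside[OF G]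
              adj_matrices_diag[OF H] adj_matrices_diag[OF G] in auto)
        qed
      qed auto
    qed
  qed
  also have "\<dots> = (\<Prod>e\<in>node_pairs n. measure_pmf.prob A {H. (case e of (i, j) \<Rightarrow> \<lambda>G. G i j) H \<in> {G (fst e) (snd e)}})"
    by (rule indep_vars_measure_pmf_subset[OF finite_node_pairs order_refl AD(6)])
  also have "\<dots> = (\<Prod>(i, j)\<in>node_pairs n. if G i j = 1 then P i j else 1 - P i j)"
  proof (rule prod.cong[OF refl])
    fix e assume e: "e \<in> node_pairs n"
    obtain i j where e_def: "e = (i, j)" by (cases e)
    have ij: "(i, j) \<in> node_pairs n" using e by (simp add: e_def)
    have one: "measure_pmf.prob A {H. H i j = 1} = P i j"
      by (rule AD(5)[OF ij])
    have "measure_pmf.prob A {H. H i j = 0} = measure_pmf.prob A (- {H. H i j = 1})"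
    proof (rule measure_pmf.finite_measure_eq_AE; simp add: AE_measure_pmf_iff)
      show "\<forall>H\<in>set_pmf A. (H i j = 0) = (H i j \<noteq> Suc 0)"
        using adj_matrices_01[OF graph_modelD[OF AD(1)], of _ i j] by fastforce
    qed
    also have "\<dots> = 1 - P i j"
      using measure_pmf.prob_compl[of "{H. H i j = 1}" A] one by (simp add: Compl_eq_Diff_UNIV)
    finally have zero: "measure_pmf.prob A {H. H i j = 0} = 1 - P i j" .
    show "measure_pmf.prob A {H. (case e of (i, j) \<Rightarrow> \<lambda>G. G i j) H \<in> {G (fst e) (snd e)}} =
        (case e of (i, j) \<Rightarrow> if G i j = 1 then P i j else 1 - P i j)"
      using adj_matrices_01[OF G, of i j] one zero by (auto simp: e_def)
  qed
  finally show ?thesis .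
qed

lemma edge_independent_triangles_le:
  assumes A: "edge_independent n A" and V: "Vol n A > 0"
  shows "expected_triangles n A \<le> 1/6 * real n ^ 3 * Ov n A ^ 3"
proof -
  obtain P where P: "edge_independent_with n P A"
    using A unfolding edge_independent_def by blast
  note g = edge_independent_withD(1)[OF P]
  note Ov_pos = Ov_nonneg[OF g]
  have "(6 * expected_triangles n A)\<^sup>2 \<le> (\<Sum>i\<in>{1..n}. \<Sum>j\<in>{1..n}. (edge_mean A i j)\<^sup>2) ^ 3"
    by (rule expected_triangles_squared_le[OF g edge_mean_nonneg])
       (simp add: edge_independent_with_triangle_mean[OF P] edge_independent_with_edge_mean[OF P])
  also have "\<dots> = (Ov n A * (2 * Vol n A)) ^ 3"
    unfolding Ov_Vol_eq_sum2[OF g V, symmetric] by (simp add: mult_ac)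
  \<comment> \<open>One overlap factor is present already and the volume bound supplies a second, so
    Ov^6 stands under the square and Ov^3 remains after the root.\<close>
  also have "\<dots> \<le> (Ov n A * ((real n)\<^sup>2 * Ov n A)) ^ 3"
    by (intro power_mono mult_left_mono Vol_le_Ov g V Ov_pos mult_nonneg_nonneg) (use V in simp_all)
  also have "\<dots> = (real n ^ 3 * Ov n A ^ 3)\<^sup>2"
    by (simp add: power_mult_distrib power2_eq_square power3_eq_cube mult_ac)
  finally have "6 * expected_triangles n A \<le> real n ^ 3 * Ov n A ^ 3"
    by (rule power2_le_imp_le) (use Ov_pos in simp)
  then show ?thesis by simp
qed

section \<open>Node independent models\<close>

text \<open>Fixes one choice of the witnesses hidden in the existential of
  \<open>node_independent\<close>, so that the lemmas can speak of \<open>x\<close>,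
  \<open>e\<close> and \<open>K\<close> directly.\<close>

locale node_embedding =
  fixes M :: "'w measure" and E :: "'e measure" and n :: nat and A :: "adj_matrix pmf"
    and x :: "nat \<Rightarrow> 'w \<Rightarrow> 'e" and e :: "'e \<Rightarrow> 'e \<Rightarrow> real" and K :: "'w \<Rightarrow> adj_matrix pmf"
  assumes graph: "graph_model n A" and prob_space: "prob_space M"
    and indep: "prob_space.indep_vars M (\<lambda>_. E) x {1..n}"
    and e_measurable: "(\<lambda>(a, b). e a b) \<in> borel_measurable (E \<Otimes>\<^sub>M E)"
    and e_range: "\<And>a b. a \<in> space E \<Longrightarrow> b \<in> space E \<Longrightarrow> e a b = e b a \<and> 0 \<le> e a b \<and> e a b \<le> 1"
    and K: "\<And>\<omega>. \<omega> \<in> space M \<Longrightarrow> edge_independent_with n (\<lambda>i j. e (x i \<omega>) (x j \<omega>)) (K \<omega>)"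
    and mixture: "\<And>G. pmf A G = (\<integral>\<omega>. pmf (K \<omega>) G \<partial>M)"

sublocale node_embedding \<subseteq> prob_space M by (rule prob_space)

context node_embedding
begin

lemma x_measurable: "i \<in> {1..n} \<Longrightarrow> x i \<in> measurable M E"
  using indep unfolding indep_vars_def by auto

lemma x_space: "i \<in> {1..n} \<Longrightarrow> \<omega> \<in> space M \<Longrightarrow> x i \<omega> \<in> space E"
  by (rule measurable_space[OF x_measurable])

lemma edge_weight_measurable:
  assumes "i \<in> {1..n}" "j \<in> {1..n}"
  shows "(\<lambda>\<omega>. e (x i \<omega>) (x j \<omega>)) \<in> borel_measurable M"
proof -
  note [measurable] = x_measurable[OF assms(1)] x_measurable[OF assms(2)] e_measurable
  have "(\<lambda>\<omega>. (\<lambda>(a, b). e a b) (x i \<omega>, x j \<omega>)) \<in> borel_measurable M"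
    by measurable
  then show ?thesis by simp
qed

lemma edge_weight_range:
  "i \<in> {1..n} \<Longrightarrow> j \<in> {1..n} \<Longrightarrow> \<omega> \<in> space M \<Longrightarrow> 0 \<le> e (x i \<omega>) (x j \<omega>) \<and> e (x i \<omega>) (x j \<omega>) \<le> 1"
  using e_range x_space by blast

lemma integrable_unit_interval:
  assumes "f \<in> borel_measurable M" "\<And>\<omega>. \<omega> \<in> space M \<Longrightarrow> 0 \<le> f \<omega> \<and> f \<omega> \<le> (1 :: real)"
  shows "integrable M f"
  by (rule integrable_const_bound[of _ 1]) (use assms in auto)

text \<open>Measurability in \<omega> is not assumed of \<open>K\<close>; it follows from the
  product formula for the conditional law, whose factors are measurable functions of the
  embeddings.\<close>

lemma pmf_K_integrable:
  assumes G: "G \<in> adj_matrices n"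
  shows "integrable M (\<lambda>\<omega>. pmf (K \<omega>) G)"
proof (rule integrable_unit_interval)
  have "(\<lambda>\<omega>. \<Prod>(i, j)\<in>node_pairs n. if G i j = 1 then e (x i \<omega>) (x j \<omega>) else 1 - e (x i \<omega>) (x j \<omega>))
      \<in> borel_measurable M"
    by (rule borel_measurable_prod)
       (auto simp: node_pairs_def intro!: measurable_If borel_measurable_diff edge_weight_measurable)
  then show "(\<lambda>\<omega>. pmf (K \<omega>) G) \<in> borel_measurable M"
    by (rule measurable_cong[THEN iffD1, rotated]) (simp add: edge_independent_with_pmf[OF K G])
qed (simp add: pmf_le_1)

text \<open>The law of total expectation. Expectations are finite sums over adjacency matrices, so
  the mixture identity for single graphs extends by linearity.\<close>

lemma expectation_mixture:
  fixes f :: "adj_matrix \<Rightarrow> real"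
  shows "measure_pmf.expectation A f = (\<integral>\<omega>. measure_pmf.expectation (K \<omega>) f \<partial>M)"
proof -
  have fin: "measure_pmf.expectation B f = (\<Sum>G\<in>adj_matrices n. pmf B G * f G)" if "graph_model n B" for B
    by (subst integral_measure_pmf[OF finite_adj_matrices])
       (use that in \<open>auto simp: graph_model_def\<close>)
  have "(\<integral>\<omega>. measure_pmf.expectation (K \<omega>) f \<partial>M) = (\<integral>\<omega>. (\<Sum>G\<in>adj_matrices n. pmf (K \<omega>) G * f G) \<partial>M)"
    by (rule Bochner_Integration.integral_cong[OF refl]) (use fin edge_independent_withD(1)[OF K] in blast)
  also have "\<dots> = (\<Sum>G\<in>adj_matrices n. pmf A G * f G)"
    by (subst Bochner_Integration.integral_sum) (auto simp: mixture pmf_K_integrable)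
  also have "\<dots> = measure_pmf.expectation A f"
    by (rule fin[OF graph, symmetric])
  finally show ?thesis by simp
qed

lemma edge_mean_mixture:
  assumes "i \<in> {1..n}" "j \<in> {1..n}" "i \<noteq> j"
  shows "edge_mean A i j = (\<integral>\<omega>. e (x i \<omega>) (x j \<omega>) \<partial>M)"
  unfolding edge_mean_def expectation_mixture
  by (rule Bochner_Integration.integral_cong[OF refl])
     (simp add: edge_independent_with_edge_mean[OF K assms, unfolded edge_mean_def])

lemma triangle_mean_mixture:
  assumes "i \<in> {1..n}" "j \<in> {1..n}" "k \<in> {1..n}" "i \<noteq> j" "j \<noteq> k" "i \<noteq> k"
  shows "triangle_mean A i j k = (\<integral>\<omega>. e (x i \<omega>) (x j \<omega>) * e (x j \<omega>) (x k \<omega>) * e (x i \<omega>) (x k \<omega>) \<partial>M)"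
  unfolding triangle_mean_def expectation_mixture
  by (rule Bochner_Integration.integral_cong[OF refl])
     (simp add: edge_independent_with_triangle_mean[OF K assms, unfolded triangle_mean_def] del: of_nat_mult)

text \<open>Given the embeddings the edges are independent, so the triangle mean integrates a
  product of three weights and Loomis--Whitney applies. Since 0 \<le> e \<le> 1 gives e^2 \<le> e,
  the squared L2 norms are at most the edge means. Weights in {0, 1} lose nothing here; the active
  clique model attains equality.\<close>

lemma triangle_mean_le:
  assumes i: "i \<in> {1..n}" and j: "j \<in> {1..n}" and k: "k \<in> {1..n}"
    and ne: "i \<noteq> j" "j \<noteq> k" "i \<noteq> k"
  shows "triangle_mean A i j k \<le> sqrt (edge_mean A i j) * sqrt (edge_mean A j k) * sqrt (edge_mean A i k)"
proof -
  let ?f = "\<lambda>a b. ennreal (e a b)"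
  have f: "case_prod ?f \<in> borel_measurable (E \<Otimes>\<^sub>M E)"
    using e_measurable by (simp add: case_prod_unfold)
  have sq_le: "(\<integral>\<^sup>+\<omega>. (?f (x a \<omega>) (x b \<omega>))\<^sup>2 \<partial>M) \<le> ennreal (edge_mean A a b)"
    if ab: "a \<in> {1..n}" "b \<in> {1..n}" "a \<noteq> b" for a b
  proof -
    have "(\<integral>\<^sup>+\<omega>. (?f (x a \<omega>) (x b \<omega>))\<^sup>2 \<partial>M) \<le> (\<integral>\<^sup>+\<omega>. ennreal (e (x a \<omega>) (x b \<omega>)) \<partial>M)"
    proof (rule nn_integral_mono)
      fix \<omega> assume "\<omega> \<in> space M"
      then have r: "0 \<le> e (x a \<omega>) (x b \<omega>)" "e (x a \<omega>) (x b \<omega>) \<le> 1"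
        using edge_weight_range[OF ab(1,2)] by auto
      then have "(e (x a \<omega>) (x b \<omega>))\<^sup>2 \<le> e (x a \<omega>) (x b \<omega>)"
        by (simp add: power2_eq_square mult_left_le)
      then show "(?f (x a \<omega>) (x b \<omega>))\<^sup>2 \<le> ennreal (e (x a \<omega>) (x b \<omega>))"
        using r by (simp add: ennreal_power ennreal_leI)
    qed
    also have "\<dots> = ennreal (edge_mean A a b)"
      unfolding edge_mean_mixture[OF ab]
      by (rule nn_integral_eq_integral)
         (use ab edge_weight_range in \<open>auto intro!: integrable_unit_interval edge_weight_measurable AE_I2\<close>)
    finally show ?thesis .
  qed
  \<comment> \<open>The product of weights is measurable and bounded by 1, so the real integral and
    the nonnegative integral agree and the inequality can be used and then read back in the
    reals.\<close>
  have "ennreal (triangle_mean A i j k) =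
      (\<integral>\<^sup>+\<omega>. ennreal (e (x i \<omega>) (x j \<omega>) * e (x j \<omega>) (x k \<omega>) * e (x i \<omega>) (x k \<omega>)) \<partial>M)"
    unfolding triangle_mean_mixture[OF assms]
  proof (rule nn_integral_eq_integral[symmetric])
    have nonneg: "0 \<le> e (x i \<omega>) (x j \<omega>) * e (x j \<omega>) (x k \<omega>) * e (x i \<omega>) (x k \<omega>)"
      and "e (x i \<omega>) (x j \<omega>) * e (x j \<omega>) (x k \<omega>) * e (x i \<omega>) (x k \<omega>) \<le> 1" if "\<omega> \<in> space M" for \<omega>
      using edge_weight_range[OF i j that] edge_weight_range[OF j k that] edge_weight_range[OF i k that]
      by (auto intro!: mult_le_one)
    then show "integrable M (\<lambda>\<omega>. e (x i \<omega>) (x j \<omega>) * e (x j \<omega>) (x k \<omega>) * e (x i \<omega>) (x k \<omega>))"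
      using i j k by (intro integrable_unit_interval borel_measurable_times edge_weight_measurable) auto
    show "AE \<omega> in M. 0 \<le> e (x i \<omega>) (x j \<omega>) * e (x j \<omega>) (x k \<omega>) * e (x i \<omega>) (x k \<omega>)"
      by (rule AE_I2) (rule nonneg)
  qed
  also have "\<dots> = (\<integral>\<^sup>+\<omega>. ?f (x i \<omega>) (x j \<omega>) * ?f (x j \<omega>) (x k \<omega>) * ?f (x i \<omega>) (x k \<omega>) \<partial>M)"
    by (rule nn_integral_cong)
       (use edge_weight_range[OF i j] edge_weight_range[OF j k] edge_weight_range[OF i k]
         in \<open>auto simp: ennreal_mult\<close>)
  finally have "(ennreal (triangle_mean A i j k))\<^sup>2 \<le>
      (\<integral>\<^sup>+\<omega>. (?f (x i \<omega>) (x j \<omega>))\<^sup>2 \<partial>M) * (\<integral>\<^sup>+\<omega>. (?f (x j \<omega>) (x k \<omega>))\<^sup>2 \<partial>M) *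
      (\<integral>\<^sup>+\<omega>. (?f (x i \<omega>) (x k \<omega>))\<^sup>2 \<partial>M)"
    using indep_vars_loomis_whitney[OF indep assms f] by simp
  also have "\<dots> \<le> ennreal (edge_mean A i j) * ennreal (edge_mean A j k) * ennreal (edge_mean A i k)"
    by (intro mult_mono sq_le assms) auto
  also have "\<dots> = ennreal (edge_mean A i j * edge_mean A j k * edge_mean A i k)"
    by (simp add: ennreal_mult edge_mean_nonneg)
  finally have "(triangle_mean A i j k)\<^sup>2 \<le> edge_mean A i j * edge_mean A j k * edge_mean A i k"
    by (simp add: ennreal_power triangle_mean_nonneg edge_mean_nonneg)
  then have "triangle_mean A i j k \<le> sqrt (edge_mean A i j * edge_mean A j k * edge_mean A i k)"
    by (rule real_le_rsqrt)
  then show ?thesis by (simp add: real_sqrt_mult)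
qed

end

lemma node_independent_triangle_mean_le:
  assumes "node_independent M E n A"
    and "i \<in> {1..n}" "j \<in> {1..n}" "k \<in> {1..n}" "i \<noteq> j" "j \<noteq> k" "i \<noteq> k"
  shows "triangle_mean A i j k \<le> sqrt (edge_mean A i j) * sqrt (edge_mean A j k) * sqrt (edge_mean A i k)"
proof -
  from assms(1) obtain x e K where "node_embedding M E n A x e K"
    unfolding node_independent_def node_embedding_def by blast
  then interpret node_embedding M E n A x e K .
  show ?thesis by (rule triangle_mean_le) fact+
qed

text \<open>Trades the real exponent for natural powers, which suit the squared estimates. The case
  \<open>v = 0\<close> is separate: there \<open>powr\<close> has the value 0.\<close>

lemma powr_three_halves: "0 \<le> v \<Longrightarrow> v powr (3/2) = sqrt v ^ 3" for v :: real
proof -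
  assume v: "0 \<le> v"
  have "v powr (3/2) = (v powr (1/2)) powr 3" by (simp add: powr_powr)
  also have "\<dots> = sqrt v ^ 3"
    using v by (cases "v = 0") (simp_all add: powr_half_sqrt powr_numeral)
  finally show ?thesis .
qed

lemma node_independent_triangles_le:
  assumes A: "node_independent M E n A" and V: "Vol n A > 0"
  shows "expected_triangles n A \<le> 1/6 * real n ^ 3 * Ov n A powr (3/2)"
proof -
  have g: "graph_model n A"
    using A unfolding node_independent_def by blast
  note Ov_pos = Ov_nonneg[OF g]
  \<comment> \<open>With square roots as weights the squares sum to 2 Vol alone, without the overlap
    factor of the edge independent case; hence half the exponent.\<close>
  have "(6 * expected_triangles n A)\<^sup>2 \<le> (\<Sum>i\<in>{1..n}. \<Sum>j\<in>{1..n}. (sqrt (edge_mean A i j))\<^sup>2) ^ 3"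
    by (rule expected_triangles_squared_le[OF g _ node_independent_triangle_mean_le[OF A]])
       (auto simp: edge_mean_nonneg)
  also have "\<dots> = (2 * Vol n A) ^ 3"
    unfolding Vol_eq_sum2[OF g] by (simp add: edge_mean_nonneg)
  also have "\<dots> \<le> ((real n)\<^sup>2 * Ov n A) ^ 3"
    by (intro power_mono Vol_le_Ov g V) (use V in simp)
  also have "\<dots> = (real n ^ 3 * sqrt (Ov n A) ^ 3)\<^sup>2"
  proof -
    have "(real n)\<^sup>2 * Ov n A = (real n * sqrt (Ov n A))\<^sup>2"
      using Ov_pos by (simp add: power_mult_distrib)
    then show ?thesis
      by (simp only: power_mult_distrib power_mult[symmetric] mult.commute)
  qed
  finally have "6 * expected_triangles n A \<le> real n ^ 3 * sqrt (Ov n A) ^ 3"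
    by (rule power2_le_imp_le) (use Ov_pos in simp)
  then show ?thesis using Ov_pos by (simp add: powr_three_halves)
qed

section \<open>The three extremal models\<close>

text \<open>Padding the product with factors 1 outside \<open>S\<close> makes it range over all
  coordinates, where the product rule for \<open>Pi_pmf\<close> applies.\<close>

lemma expectation_prod_bernoulli_Pi_pmf:
  assumes "finite A" "S \<subseteq> A" "p \<in> {0..1}"
  shows "measure_pmf.expectation (Pi_pmf A d (\<lambda>_. bernoulli_pmf p)) (\<lambda>b. \<Prod>x\<in>S. of_bool (b x)) = (p :: real) ^ card S"
proof -
  have "measure_pmf.expectation (Pi_pmf A d (\<lambda>_. bernoulli_pmf p)) (\<lambda>b. \<Prod>x\<in>S. of_bool (b x) :: real)
      = measure_pmf.expectation (Pi_pmf A d (\<lambda>_. bernoulli_pmf p))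
          (\<lambda>b. \<Prod>x\<in>A. if x \<in> S then of_bool (b x) else 1)"
    using assms(1,2) by (simp add: prod.inter_restrict[symmetric] Int_absorb1)
  also have "\<dots> = (\<Prod>x\<in>A. measure_pmf.expectation (bernoulli_pmf p) (\<lambda>v. if x \<in> S then of_bool v else 1))"
    by (rule expectation_prod_Pi_pmf)
       (auto simp: assms(1) intro!: integrable_measure_pmf_finite)
  also have "\<dots> = (\<Prod>x\<in>A. if x \<in> S then p else 1)"
    using assms(3) by (intro prod.cong refl) auto
  also have "\<dots> = p ^ card S"
    using assms(1,2) by (simp add: prod.inter_restrict[symmetric] Int_absorb1)
  finally show ?thesis .
qed

text \<open>At an index i < j the matrix entry is the coordinate (i, j) of the product distribution,
  up to the conversion from truth values to numbers, so independence of the coordinates carries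
  over.\<close>

lemma gnp_edge_independent:
  assumes p: "p \<in> {0..1}"
  shows "edge_independent_with n (\<lambda>_ _. p) (gnp_model n p)"
proof -
  let ?Q = "Pi_pmf (node_pairs n) False (\<lambda>_. bernoulli_pmf p)"
  let ?G = "\<lambda>b. adj_of n (\<lambda>i j. b (min i j, max i j))"
  have G: "?G b i j = of_bool (b (i, j))" if "(i, j) \<in> node_pairs n" for b i j
    using that by (auto simp: adj_of_def node_pairs_def)
  have "graph_model n (gnp_model n p)"
    unfolding graph_model_def gnp_model_def set_map_pmf
    by (auto intro!: adj_of_in_adj_matrices simp: symp_def min.commute max.commute)
  moreover have "measure_pmf.prob (gnp_model n p) {G. G i j = 1} = p" if ij: "(i, j) \<in> node_pairs n" for i j
  proof -
    have "measure_pmf.prob (gnp_model n p) {G. G i j = 1} = measure_pmf.prob ?Q ((\<lambda>b. b (i, j)) -` {True})"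
      unfolding gnp_model_def measure_map_pmf
      by (rule arg_cong[of _ _ "measure_pmf.prob ?Q"]) (auto simp: G[OF ij] simp del: One_nat_def)
    also have "\<dots> = pmf (map_pmf (\<lambda>b. b (i, j)) ?Q) True"
      by (simp add: pmf.rep_eq)
    also have "map_pmf (\<lambda>b. b (i, j)) ?Q = bernoulli_pmf p"
      using ij by (simp add: Pi_pmf_component finite_node_pairs)
    finally show ?thesis using p by simp
  qed
  moreover have "prob_space.indep_vars (measure_pmf (gnp_model n p)) (\<lambda>_. count_space UNIV)
      (\<lambda>(i, j) G. G i j) (node_pairs n)"
  proof -
    have "prob_space.indep_vars (measure_pmf ?Q) (\<lambda>_. count_space UNIV)
        (\<lambda>e b. of_bool (b e) :: nat) (node_pairs n)"
      by (rule prob_space.indep_vars_compose2[OF measure_pmf.prob_space_axioms indep_vars_Pi_pmf[OF finite_node_pairs]])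
         simp
    moreover have "prob_space.indep_vars (measure_pmf ?Q) (\<lambda>_. count_space UNIV)
          (\<lambda>e b. (case e of (i, j) \<Rightarrow> \<lambda>G. G i j) (?G b)) (node_pairs n) \<longleftrightarrow>
        prob_space.indep_vars (measure_pmf ?Q) (\<lambda>_. count_space UNIV)
          (\<lambda>e b. of_bool (b e) :: nat) (node_pairs n)"
      by (rule prob_space.indep_vars_cong[OF measure_pmf.prob_space_axioms]) (auto simp: G)
    ultimately show ?thesis
      unfolding gnp_model_def indep_vars_map_pmf_iff[OF finite_node_pairs] by blast
  qed
  ultimately show ?thesis
    using p unfolding edge_independent_with_def by auto
qed

lemma graph_model_active_clique: "graph_model n (active_clique_model n p)"
  unfolding graph_model_def active_clique_model_def set_map_pmf
  by (auto intro!: adj_of_in_adj_matrices simp: symp_def)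

lemma graph_model_all_or_nothing: "graph_model n (all_or_nothing_model n p)"
  unfolding graph_model_def all_or_nothing_model_def set_map_pmf
  by (auto intro!: adj_of_in_adj_matrices simp: symp_def)

text \<open>A deterministic graph is edge independent with probabilities 0 and 1. The active clique
  model is of this kind once the activities are fixed.\<close>

lemma edge_independent_with_return_pmf:
  assumes "symp R"
  shows "edge_independent_with n (\<lambda>i j. of_bool (R i j)) (return_pmf (adj_of n R))"
  unfolding edge_independent_with_def
proof (intro conjI)
  show "graph_model n (return_pmf (adj_of n R))"
    using adj_of_in_adj_matrices[OF assms] by (simp add: graph_model_def)
  show "\<forall>i\<in>{1..n}. \<forall>j\<in>{1..n}. of_bool (R i j) = (of_bool (R j i) :: real) \<and> (0 :: real) \<le> of_bool (R i j) \<and>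
      of_bool (R i j) \<le> (1 :: real)"
    using assms by (auto dest: sympD)
  show "\<forall>(i, j)\<in>node_pairs n. measure_pmf.prob (return_pmf (adj_of n R)) {G. G i j = 1} = of_bool (R i j)"
    by (auto simp: measure_return_pmf adj_of_def node_pairs_def)
qed (rule indep_vars_return_pmf[OF finite_node_pairs])

lemma active_clique_node_independent:
  "node_independent (measure_pmf (Pi_pmf {1..n} False (\<lambda>_. bernoulli_pmf (sqrt p))))
     (count_space (UNIV :: bool set)) n
     (active_clique_model n p)"
  (is "node_independent (measure_pmf ?Q) _ _ _")
proof -
  \<comment> \<open>The embedding of a node is its activity bit, read off the product space of all
    bits; the weight is conjunction, and the conditional law is a point mass.\<close>
  let ?e = "\<lambda>a b. of_bool (a \<and> b) :: real"
  let ?K = "\<lambda>a. return_pmf (adj_of n (\<lambda>i j. a i \<and> a j))"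
  have "prob_space.indep_vars (measure_pmf ?Q) (\<lambda>_. count_space UNIV) (\<lambda>i a. a i) {1..n}"
    by (rule indep_vars_Pi_pmf) simp
  moreover have "(\<lambda>(a, b). ?e a b) \<in> borel_measurable (count_space (UNIV :: bool set) \<Otimes>\<^sub>M count_space UNIV)"
    by (simp add: pair_measure_countable)
  moreover have "edge_independent_with n (\<lambda>i j. ?e (a i) (a j)) (?K a)" for a
    by (rule edge_independent_with_return_pmf) (auto simp: symp_def)
  moreover have "pmf (active_clique_model n p) G = (\<integral>a. pmf (?K a) G \<partial>?Q)" for G
    unfolding active_clique_model_def map_pmf_def by (simp add: pmf_bind)
  ultimately show ?thesis
    unfolding node_independent_def
    by (intro conjI graph_model_active_clique measure_pmf.prob_space_axioms
          exI[of _ "\<lambda>i a. a i"] exI[of _ ?e] exI[of _ ?K] ballI allI; (assumption | auto))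
qed

text \<open>An edge needs its two distinct end points active, which has probability (sqrt p)^2; this
  is why nodes are activated with probability sqrt p.\<close>

lemma active_clique_edge_mean:
  assumes p: "p \<in> {0..1}" and ij: "(i, j) \<in> node_pairs n"
  shows "edge_mean (active_clique_model n p) i j = p"
proof -
  have "edge_mean (active_clique_model n p) i j =
      measure_pmf.expectation (Pi_pmf {1..n} False (\<lambda>_. bernoulli_pmf (sqrt p))) (\<lambda>a. \<Prod>v\<in>{i, j}. of_bool (a v))"
    unfolding edge_mean_def active_clique_model_def integral_map_pmf
    by (rule Bochner_Integration.integral_cong) (use ij in \<open>auto simp: adj_of_def node_pairs_def\<close>)
  also have "\<dots> = sqrt p ^ card {i, j}"
    by (rule expectation_prod_bernoulli_Pi_pmf) (use ij p in \<open>auto simp: node_pairs_def\<close>)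
  also have "\<dots> = p"
    using ij p by (simp add: node_pairs_def)
  finally show ?thesis .
qed

text \<open>A triangle needs only three active nodes, hence p^(3/2), whereas three independent edges
  would give p^3.\<close>

lemma active_clique_triangle_mean:
  assumes p: "p \<in> {0..1}"
    and ijk: "i \<in> {1..n}" "j \<in> {1..n}" "k \<in> {1..n}" "i \<noteq> j" "j \<noteq> k" "i \<noteq> k"
  shows "triangle_mean (active_clique_model n p) i j k = sqrt p ^ 3"
proof -
  have "triangle_mean (active_clique_model n p) i j k =
      measure_pmf.expectation (Pi_pmf {1..n} False (\<lambda>_. bernoulli_pmf (sqrt p))) (\<lambda>a. \<Prod>v\<in>{i, j, k}. of_bool (a v))"
    unfolding triangle_mean_def active_clique_model_def integral_map_pmf
    by (rule Bochner_Integration.integral_cong) (use ijk in \<open>auto simp: adj_of_def\<close>)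
  also have "\<dots> = sqrt p ^ card {i, j, k}"
    by (rule expectation_prod_bernoulli_Pi_pmf) (use ijk p in auto)
  also have "card {i, j, k} = 3"
    using ijk by simp
  finally show ?thesis .
qed

lemma all_or_nothing_edge_mean:
  assumes "p \<in> {0..1}" "(i, j) \<in> node_pairs n"
  shows "edge_mean (all_or_nothing_model n p) i j = p"
  unfolding edge_mean_def all_or_nothing_model_def integral_map_pmf
  using assms by (auto simp: adj_of_def node_pairs_def)

lemma all_or_nothing_triangle_mean:
  assumes "p \<in> {0..1}" "i \<in> {1..n}" "j \<in> {1..n}" "k \<in> {1..n}" "i \<noteq> j" "j \<noteq> k" "i \<noteq> k"
  shows "triangle_mean (all_or_nothing_model n p) i j k = p"
  unfolding triangle_mean_def all_or_nothing_model_def integral_map_pmf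
  using assms by (auto simp: adj_of_def)

text \<open>The general estimate (n/k)^k \<le> n choose k at k = 3; the source of the constant
  1/27.\<close>

lemma choose_3_ge: "n \<ge> 3 \<Longrightarrow> real n ^ 3 / 27 \<le> real (n choose 3)"
  using binomial_ge_n_over_k_pow_k[of 3 n, where ?'a = real] by (simp add: power_divide)

section \<open>Overlaps and triangle counts of the three example models\<close>

context
  fixes n :: nat and p :: real
  assumes n: "n \<ge> 3" and p: "p \<in> {0<..1}"
begin

lemma gnp_Vol_Ov: "Vol n (gnp_model n p) > 0" "Ov n (gnp_model n p) = p"
proof -
  have P: "edge_independent_with n (\<lambda>_ _. p) (gnp_model n p)"
    using gnp_edge_independent p by simp
  have "edge_mean (gnp_model n p) i j = p" if "(i, j) \<in> node_pairs n" for i j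
    using edge_independent_with_edge_mean[OF P, of i j] that by (auto simp: node_pairs_def)
  then show "Vol n (gnp_model n p) > 0" "Ov n (gnp_model n p) = p"
    using Vol_Ov_uniform[OF edge_independent_withD(1)[OF P]] n p by auto
qed

lemma gnp_triangles: "expected_triangles n (gnp_model n p) = p ^ 3 * real (n choose 3)"
proof -
  have P: "edge_independent_with n (\<lambda>_ _. p) (gnp_model n p)"
    using gnp_edge_independent p by simp
  show ?thesis
    by (rule expected_triangles_uniform[OF edge_independent_withD(1)[OF P]])
       (simp add: edge_independent_with_triangle_mean[OF P] power3_eq_cube)
qed

lemma active_clique_Vol_Ov:
  "Vol n (active_clique_model n p) > 0" "Ov n (active_clique_model n p) = p"
  using Vol_Ov_uniform[OF graph_model_active_clique, of p n p] active_clique_edge_mean[of p] n p by auto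

lemma active_clique_triangles:
  "expected_triangles n (active_clique_model n p) = p powr (3/2) * real (n choose 3)"
proof -
  have "expected_triangles n (active_clique_model n p) = sqrt p ^ 3 * real (n choose 3)"
    by (rule expected_triangles_uniform[OF graph_model_active_clique])
       (use p in \<open>simp add: active_clique_triangle_mean\<close>)
  then show ?thesis using p by (simp add: powr_three_halves)
qed

lemma all_or_nothing_Vol_Ov:
  "Vol n (all_or_nothing_model n p) > 0" "Ov n (all_or_nothing_model n p) = p"
  using Vol_Ov_uniform[OF graph_model_all_or_nothing, of p n p] all_or_nothing_edge_mean[of p] n p by auto

lemma all_or_nothing_triangles:
  "expected_triangles n (all_or_nothing_model n p) = p * real (n choose 3)"
  by (rule expected_triangles_uniform[OF graph_model_all_or_nothing])
     (use p in \<open>simp add: all_or_nothing_triangle_mean\<close>)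

lemmas model_Vol_Ov = gnp_Vol_Ov active_clique_Vol_Ov all_or_nothing_Vol_Ov

lemma model_triangles_ge:
  "1/27 * (real n ^ 3 * Ov n (gnp_model n p) ^ 3) \<le> expected_triangles n (gnp_model n p)"
  "1/27 * (real n ^ 3 * Ov n (active_clique_model n p) powr (3/2))
     \<le> expected_triangles n (active_clique_model n p)"
  "1/27 * (real n ^ 3 * Ov n (all_or_nothing_model n p)) \<le> expected_triangles n (all_or_nothing_model n p)"
  unfolding model_Vol_Ov gnp_triangles active_clique_triangles all_or_nothing_triangles
  using mult_left_mono[OF choose_3_ge[OF n], of "p ^ 3"]
    mult_left_mono[OF choose_3_ge[OF n], of "p powr (3/2)"] mult_left_mono[OF choose_3_ge[OF n], of p] p
  by (simp_all add: mult.commute)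

lemma models_in_classes:
  "edge_independent n (gnp_model n p)"
  "\<exists>(M :: (nat \<Rightarrow> bool) measure) (E :: bool measure). node_independent M E n (active_clique_model n p)"
  "fully_dependent n (all_or_nothing_model n p)"
proof -
  have "edge_independent_with n (\<lambda>_ _. p) (gnp_model n p)"
    using gnp_edge_independent p by simp
  then show "edge_independent n (gnp_model n p)"
    unfolding edge_independent_def by blast
  show "\<exists>(M :: (nat \<Rightarrow> bool) measure) (E :: bool measure). node_independent M E n (active_clique_model n p)"
    using active_clique_node_independent by blast
  show "fully_dependent n (all_or_nothing_model n p)"
    using graph_model_all_or_nothing unfolding fully_dependent_def .
qed

end

section \<open>Upper bounds for the classes and their tightness\<close>

lemma upper_bounds:
  "triangle_upper_bound edge_independent (\<lambda>n v. 1/6 * real n ^ 3 * v ^ 3)"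
  "triangle_upper_bound (node_independent M E) (\<lambda>n v. 1/6 * real n ^ 3 * v powr (3/2))"
  unfolding triangle_upper_bound_def
  using edge_independent_triangles_le node_independent_triangles_le by blast+

text \<open>The overlap is nonnegative, so the constant 1/6 may be enlarged; the case
  \<open>c = 1/2\<close> is the one stated in the theorem.\<close>

lemma fully_dependent_upper_bound:
  assumes "c \<ge> 1/6"
  shows "triangle_upper_bound fully_dependent (\<lambda>n v. c * real n ^ 3 * v)"
  unfolding triangle_upper_bound_def fully_dependent_def
proof (intro allI impI, elim conjE)
  fix n A assume A: "graph_model n A" "Vol n A > 0"
  have "expected_triangles n A \<le> 1/6 * (real n ^ 3 * Ov n A)"
    using fully_dependent_triangles_le[OF A] by (simp add: mult.assoc)
  also have "\<dots> \<le> c * (real n ^ 3 * Ov n A)"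
    by (rule mult_right_mono[OF assms]) (simp add: Ov_nonneg[OF A(1)])
  finally show "expected_triangles n A \<le> c * real n ^ 3 * Ov n A"
    by (simp add: mult.assoc)
qed

lemma triangle_bound_attainedI:
  assumes "c > 0"
    and "\<And>n p. n \<ge> 3 \<Longrightarrow> p \<in> {0<..1} \<Longrightarrow> C n (A n p) \<and> Vol n (A n p) > 0 \<and> Ov n (A n p) = p \<and>
      c * U n (Ov n (A n p)) \<le> expected_triangles n (A n p)"
  shows "triangle_bound_attained C U"
  unfolding triangle_bound_attained_def using assms by blast

lemma bounds_attained:
  "triangle_bound_attained edge_independent (\<lambda>n v. 1/6 * real n ^ 3 * v ^ 3)"
  "triangle_bound_attained
     (\<lambda>n A. \<exists>(M :: (nat \<Rightarrow> bool) measure) (E :: bool measure). node_independent M E n A)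
     (\<lambda>n v. 1/6 * real n ^ 3 * v powr (3/2))"
  "triangle_bound_attained fully_dependent (\<lambda>n v. 1/2 * real n ^ 3 * v)"
proof -
  \<comment> \<open>The bound itself carries 1/6, so the witness 6/27 leaves the constant 1/27 of
    \<open>model_triangles_ge\<close>. For the fully dependent bound with 1/2 the matching witness
    is 2/27.\<close>
  show "triangle_bound_attained edge_independent (\<lambda>n v. 1/6 * real n ^ 3 * v ^ 3)"
    by (rule triangle_bound_attainedI[of "6/27" _ gnp_model])
       (use models_in_classes(1) gnp_Vol_Ov model_triangles_ge(1) in \<open>auto simp: mult_ac\<close>)
  show "triangle_bound_attained
     (\<lambda>n A. \<exists>(M :: (nat \<Rightarrow> bool) measure) (E :: bool measure). node_independent M E n A)
     (\<lambda>n v. 1/6 * real n ^ 3 * v powr (3/2))"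
    by (rule triangle_bound_attainedI[of "6/27" _ active_clique_model])
       (use models_in_classes(2) active_clique_Vol_Ov model_triangles_ge(2) in \<open>auto simp: mult_ac\<close>)
  show "triangle_bound_attained fully_dependent (\<lambda>n v. 1/2 * real n ^ 3 * v)"
    by (rule triangle_bound_attainedI[of "2/27" _ all_or_nothing_model])
       (use models_in_classes(3) all_or_nothing_Vol_Ov model_triangles_ge(3) in \<open>auto simp: mult_ac\<close>)
qed

text \<open>The upper half of each \<Theta> is the general bound of the class, applied to the
  example as a member of it.\<close>

lemma model_triangles_le:
  assumes "n \<ge> 3" "p \<in> {0<..1}"
  shows "expected_triangles n (gnp_model n p) \<le> 1/6 * (real n ^ 3 * Ov n (gnp_model n p) ^ 3)"
    and "expected_triangles n (active_clique_model n p)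
      \<le> 1/6 * (real n ^ 3 * Ov n (active_clique_model n p) powr (3/2))"
    and "expected_triangles n (all_or_nothing_model n p) \<le> 1/6 * (real n ^ 3 * Ov n (all_or_nothing_model n p))"
  using edge_independent_triangles_le[OF models_in_classes(1) gnp_Vol_Ov(1), OF assms assms]
    node_independent_triangles_le[OF active_clique_node_independent active_clique_Vol_Ov(1), OF assms]
    fully_dependent_triangles_le[OF graph_model_all_or_nothing all_or_nothing_Vol_Ov(1), OF assms]
  by (simp_all add: mult.assoc)

theorem mainTheorem4:
  shows
    "(\<forall>n\<ge>3. \<forall>p\<in>{0<..1::real}.
         edge_independent n (gnp_model n p) \<and>
         (\<exists>(M :: (nat \<Rightarrow> bool) measure) (E :: bool measure).
             node_independent M E n (active_clique_model n p)) \<and>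
         fully_dependent n (all_or_nothing_model n p) \<and>
         Vol n (gnp_model n p) > 0 \<and> Ov n (gnp_model n p) = p \<and>
         Vol n (active_clique_model n p) > 0 \<and> Ov n (active_clique_model n p) = p \<and>
         Vol n (all_or_nothing_model n p) > 0 \<and> Ov n (all_or_nothing_model n p) = p) \<and>
     (\<exists>c>0. \<exists>C>0. \<forall>n\<ge>3. \<forall>p\<in>{0<..1::real}.
         c * (real n ^ 3 * Ov n (gnp_model n p) ^ 3) \<le> expected_triangles n (gnp_model n p) \<and>
         expected_triangles n (gnp_model n p) \<le> C * (real n ^ 3 * Ov n (gnp_model n p) ^ 3)) \<and>
     (\<exists>c>0. \<exists>C>0. \<forall>n\<ge>3. \<forall>p\<in>{0<..1::real}.
         c * (real n ^ 3 * Ov n (active_clique_model n p) powr (3/2))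
           \<le> expected_triangles n (active_clique_model n p) \<and>
         expected_triangles n (active_clique_model n p)
           \<le> C * (real n ^ 3 * Ov n (active_clique_model n p) powr (3/2))) \<and>
     (\<exists>c>0. \<exists>C>0. \<forall>n\<ge>3. \<forall>p\<in>{0<..1::real}.
         c * (real n ^ 3 * Ov n (all_or_nothing_model n p))
           \<le> expected_triangles n (all_or_nothing_model n p) \<and>
         expected_triangles n (all_or_nothing_model n p)
           \<le> C * (real n ^ 3 * Ov n (all_or_nothing_model n p))) \<and>
     (triangle_upper_bound edge_independent (\<lambda>n v. 1/6 * real n ^ 3 * v ^ 3) \<and>
      triangle_bound_attained edge_independent (\<lambda>n v. 1/6 * real n ^ 3 * v ^ 3)) \<and>
     ((\<forall>(M :: 'w measure) (E :: 'e measure).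
         triangle_upper_bound (node_independent M E) (\<lambda>n v. 1/6 * real n ^ 3 * v powr (3/2))) \<and>
      triangle_bound_attained
        (\<lambda>n A. \<exists>(M :: (nat \<Rightarrow> bool) measure) (E :: bool measure). node_independent M E n A)
        (\<lambda>n v. 1/6 * real n ^ 3 * v powr (3/2))) \<and>
     (triangle_upper_bound fully_dependent (\<lambda>n v. 1/2 * real n ^ 3 * v) \<and>
      triangle_bound_attained fully_dependent (\<lambda>n v. 1/2 * real n ^ 3 * v))"
proof (intro conjI)
  \<comment> \<open>The same two constants serve all three models: 1/27 from the binomial estimate
    and 1/6 from the class bounds.\<close>
  show "\<exists>c>0. \<exists>C>0. \<forall>n\<ge>3. \<forall>p\<in>{0<..1::real}.
      c * (real n ^ 3 * Ov n (gnp_model n p) ^ 3) \<le> expected_triangles n (gnp_model n p) \<and>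
      expected_triangles n (gnp_model n p) \<le> C * (real n ^ 3 * Ov n (gnp_model n p) ^ 3)"
    by (rule exI[of _ "1/27"], rule conjI, simp, rule exI[of _ "1/6"], rule conjI, simp)
       (blast intro: model_triangles_ge model_triangles_le)
  show "\<exists>c>0. \<exists>C>0. \<forall>n\<ge>3. \<forall>p\<in>{0<..1::real}.
      c * (real n ^ 3 * Ov n (active_clique_model n p) powr (3/2))
        \<le> expected_triangles n (active_clique_model n p) \<and>
      expected_triangles n (active_clique_model n p)
        \<le> C * (real n ^ 3 * Ov n (active_clique_model n p) powr (3/2))"
    by (rule exI[of _ "1/27"], rule conjI, simp, rule exI[of _ "1/6"], rule conjI, simp)
       (blast intro: model_triangles_ge model_triangles_le)
  show "\<exists>c>0. \<exists>C>0. \<forall>n\<ge>3. \<forall>p\<in>{0<..1::real}.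
      c * (real n ^ 3 * Ov n (all_or_nothing_model n p))
        \<le> expected_triangles n (all_or_nothing_model n p) \<and>
      expected_triangles n (all_or_nothing_model n p)
        \<le> C * (real n ^ 3 * Ov n (all_or_nothing_model n p))"
    by (rule exI[of _ "1/27"], rule conjI, simp, rule exI[of _ "1/6"], rule conjI, simp)
       (blast intro: model_triangles_ge model_triangles_le)
  show "triangle_upper_bound fully_dependent (\<lambda>n v. 1/2 * real n ^ 3 * v)"
    by (rule fully_dependent_upper_bound) simp
qed (intro allI impI ballI conjI upper_bounds bounds_attained models_in_classes model_Vol_Ov; assumption)+

end
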